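(* There is no infinitely renormalizable piecewise affine map $f:[0,1]\to[0,1]$. That is, if $f:[0,1]\to[0,1]$ is piecewise affine (with finitely many pieces, each of non-zero slope), then there is no infinite sequence of cycles $\mathcal I^1\supset\mathcal I^2\supset\mathcal I^3\supset\cdots$ of $f$ in which each $\mathcal I^{n+1}$ refines $\mathcal I^n$.
   Context: A continuous map $f:[0,1]\to[0,1]$ is piecewise affine if there are finitely many points $0=c_{-1}<c_0<\dots<c_d<c_{d+1}=1$ such that $f$ is affine with non-zero slope on each interval $[c_i,c_{i+1}]$ (and $f$ is not affine on any larger interval). A cycle of a continuous map $f:[0,1]\to[0,1]$ is a finite collection $\mathcal I=\{I_0,I_1,\dots,I_{q-1}\}$ ($q\ge 1$) of pairwise disjoint closed subintervals of $[0,1]$ (single points are allowed as degenerate intervals) which are cyclically permuted by $f$ in the sense that $f(I_i)\subset I_{i+1 \bmod q}$ for all $i$. A cycle $\mathcal I^2$ refines a cycle $\mathcal I^1$, written $\mathcal I^1\supset\mathcal I^2$, if $\bigcup_{J\in\mathcal I^2}J\subset\bigcup_{I\in\mathcal I^1}I$ and, denoting by $a_{1,2}$ the number such that every interval of $\mathcal I^1$ contains exactly $a_{1,2}$ intervals of $\mathcal I^2$ (such a number exists), one has $a_{1,2}\ge 2$. A continuous map $f:[0,1]\to[0,1]$ is infinitely renormalizable if it has an infinite sequence of cycles $\mathcal I^1\supset\mathcal I^2\supset\mathcal I^3\supset\cdots$, each refining the previous one. *)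

theory Defs
  imports "HOL-Analysis.Analysis"
begin

definition interval_map :: "(real \<Rightarrow> real) \<Rightarrow> bool" where
  "interval_map f \<longleftrightarrow> continuous_on {0..1} f \<and> f ` {0..1} \<subseteq> {0..1}"

definition affine_with_slope :: "(real \<Rightarrow> real) \<Rightarrow> real \<Rightarrow> real set \<Rightarrow> bool" where
  "affine_with_slope f a S \<longleftrightarrow> (\<exists>b. \<forall>x\<in>S. f x = a * x + b)"

text \<open>
  The breakpoints are indexed from 0 rather than from -1. The case of a single piece
  (no interior breakpoint) is included. The last clause is maximality of the pieces
  among subintervals of the unit interval.
\<close>

definition piecewise_affine :: "(real \<Rightarrow> real) \<Rightarrow> bool" where
  "piecewise_affine f \<longleftrightarrow> interval_map f \<and>
     (\<exists>(c :: nat \<Rightarrow> real) n. c 0 = 0 \<and> c n = 1 \<and>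
        (\<forall>i<n. c i < c (Suc i)) \<and>
        (\<forall>i<n. \<exists>a. a \<noteq> 0 \<and> affine_with_slope f a {c i..c (Suc i)}) \<and>
        (\<forall>i<n. \<forall>J. is_interval J \<and> J \<subseteq> {0..1} \<and> {c i..c (Suc i)} \<subset> J \<longrightarrow>
           \<not> (\<exists>a. affine_with_slope f a J)))"

text \<open>
  A cycle is the set of its intervals. Since the intervals are nonempty, disjointness of the
  family makes the enumeration \<open>I\<close> injective, so that there are exactly \<open>q\<close> of them.
\<close>

definition is_cycle :: "(real \<Rightarrow> real) \<Rightarrow> real set set \<Rightarrow> bool" where
  "is_cycle f C \<longleftrightarrow>
     (\<exists>(q :: nat) I. q \<ge> 1 \<and> C = I ` {..<q} \<and>
        (\<forall>i<q. \<exists>a b. 0 \<le> a \<and> a \<le> b \<and> b \<le> 1 \<and> I i = {a..b}) \<and>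
        disjoint_family_on I {..<q} \<and>
        (\<forall>i<q. f ` I i \<subseteq> I ((i + 1) mod q)))"

definition cycle_refines :: "real set set \<Rightarrow> real set set \<Rightarrow> bool" where
  "cycle_refines C2 C1 \<longleftrightarrow>
     \<Union>C2 \<subseteq> \<Union>C1 \<and> (\<exists>m::nat. m \<ge> 2 \<and> (\<forall>I\<in>C1. card {J \<in> C2. J \<subseteq> I} = m))"

definition infinitely_renormalizable :: "(real \<Rightarrow> real) \<Rightarrow> bool" where
  "infinitely_renormalizable f \<longleftrightarrow> interval_map f \<and>
     (\<exists>C :: nat \<Rightarrow> real set set. (\<forall>n. is_cycle f (C n)) \<and>
        (\<forall>n. cycle_refines (C (Suc n)) (C n)))"

end

theory Submission
  imports Defs
begin

text \<open>
  The proof measures a cycle \<open>C\<close> by the number \<open>expansion C\<close>: the product of the absolute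
  slopes of \<open>f\<close> over those intervals of \<open>C\<close> that contain no breakpoint. Along an infinite
  sequence of refinements these numbers would have to be strictly increasing and bounded, and
  yet equal to their limit from some index on.

  Far enough in the sequence two breakpoints that lie in one interval of a cycle are never
  separated, and none is lost, by later cycles. For such a cycle \<open>C\<close> and a refinement \<open>D\<close> of
  it, the gaps between neighbouring intervals of \<open>D\<close> inside an interval of \<open>C\<close> contain no
  breakpoint, and at most one of the intervals of \<open>D\<close> inside an interval of \<open>C\<close> contains
  breakpoints. Every other interval of \<open>D\<close> has the slope of the gap next to it on the side
  facing the breakpoints; where there are none, the slope of the interval of \<open>C\<close> occurs once
  more than there are gaps. Hence \<open>expansion D = expansion C * T\<close>, where \<open>T\<close> is the product
  of the slopes over all gaps (\<open>expansion_D\<close>).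

  The map permutes the intervals of \<open>D\<close>, and it is affine on each gap. So the image of a gap
  covers all gaps between the images of its two neighbours, and by a fact on permutations
  (\<open>perm_gap_matching\<close>) there is a bijection of the gaps which assigns to every gap one that
  its image covers. Multiplying the ratios of lengths over all gaps yields \<open>T \<ge> 1\<close>. The
  products \<open>expansion C\<close> are bounded: an interval without breakpoints is stretched by its
  slope, an interval with breakpoints is shortened at most by a fixed factor, there are at
  most as many of the latter as breakpoints, and the product of all ratios of consecutive
  lengths around a cycle is one (\<open>expansion_bounded\<close>). Therefore \<open>T\<close> tends to one.

  On the other hand \<open>f\<close> has a periodic point whose period is the number of intervals of \<open>C\<close>
  and whose orbit stays in the gaps (\<open>orbit_through_gaps\<close>). The modulus \<open>\<sigma>\<close> of its multiplier
  is \<open>expansion C * \<phi>\<close> with \<open>\<phi>\<close> from a fixed finite set, since \<open>\<phi>\<close> is a product of slopes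
  over the few intervals with breakpoints. It is at least one. When \<open>T\<close> is close to one, the
  image of a gap is hardly longer than the gap assigned to it, so it has no room for another
  gap of comparable size; thus the orbit follows the bijection, and \<open>\<sigma> \<le> T\<close>
  (\<open>loop_of_covered_gaps\<close>). So \<open>\<sigma>\<close> tends to one and \<open>\<phi>\<close> to the inverse of the limit \<open>l\<close> of
  the expansions. As \<open>\<phi>\<close> takes finitely many values it finally equals \<open>1 / l\<close>, and \<open>\<sigma> \<ge> 1\<close>
  says that the expansion has reached \<open>l\<close>.

  This is impossible when \<open>T > 1\<close> at every step. If \<open>T = 1\<close>, the image of every gap on the
  orbit is exactly the next gap, so the two end points of a gap are periodic with at most
  twice the period of \<open>C\<close>; but they lie in intervals of \<open>D\<close>, whose period is at least three
  times that of \<open>C\<close> once every interval of \<open>C\<close> contains at least three intervals of \<open>D\<close>.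
  Taking every second cycle of the sequence ensures this.
\<close>

section \<open>A permutation covers gaps bijectively\<close>

text \<open>
  Gap \<open>j\<close> of the points \<open>0, \<dots>, m\<close> lies between \<open>j\<close> and \<open>Suc j\<close>, and its image is the segment
  between \<open>\<theta> j\<close> and \<open>\<theta> (Suc j)\<close>. The bijection is built by deleting the point \<open>k\<close> with the
  largest image. If \<open>k\<close> is interior, its two gaps merge to one, which by induction gets a gap
  \<open>g\<close> of the remaining points. The gap at \<open>k\<close> with the lower other end covers \<open>g\<close> and takes
  it over; both gaps at \<open>k\<close> cover the topmost gap, which goes to the other one. If \<open>k\<close> is an
  end point, its only gap gets the topmost gap.
\<close>

lemma perm_gap_matching:
  "bij_betw \<theta> {..m} {..m} \<Longrightarrow> \<exists>\<pi>. bij_betw \<pi> {..<m} {..<m} \<and>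
     (\<forall>j<m. min (\<theta> j) (\<theta> (Suc j)) \<le> \<pi> j \<and> \<pi> j < max (\<theta> j) (\<theta> (Suc j)))"
  for \<theta> :: "nat \<Rightarrow> nat"
proof (induction m arbitrary: \<theta>)
  case 0
  then show ?case by (auto intro: bij_betw_id)
next
  case (Suc m)
  have inj: "\<And>i j. i \<le> Suc m \<Longrightarrow> j \<le> Suc m \<Longrightarrow> \<theta> i = \<theta> j \<Longrightarrow> i = j"
    using bij_betw_imp_inj_on[OF Suc.prems] by (auto simp: inj_on_def)
  have le: "\<theta> i \<le> Suc m" if "i \<le> Suc m" for i
    using bij_betwE[OF Suc.prems] that by auto
  obtain k where k: "k \<le> Suc m" "\<theta> k = Suc m"
    using bij_betw_imp_surj_on[OF Suc.prems] by (metis atMost_iff imageE order_refl)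
  have lt: "\<theta> i \<le> m" if "i \<le> Suc m" "i \<noteq> k" for i
    using le[OF that(1)] inj[of i k] that k by force
  define \<theta>' where "\<theta>' j = (if j < k then \<theta> j else \<theta> (Suc j))" for j
  have "inj_on \<theta>' {..m}"
    using k(1) by (intro inj_onI) (auto simp: \<theta>'_def split: if_splits dest!: inj[rotated 2])
  moreover have "\<theta>' ` {..m} \<subseteq> {..m}"
    using k(1) by (auto simp: \<theta>'_def intro!: lt)
  ultimately have "bij_betw \<theta>' {..m} {..m}"
    by (simp add: bij_betw_def endo_inj_surj)
  from Suc.IH[OF this] obtain \<pi>' where \<pi>': "bij_betw \<pi>' {..<m} {..<m}"
    and cov: "\<And>j. j < m \<Longrightarrow> min (\<theta>' j) (\<theta>' (Suc j)) \<le> \<pi>' j \<and> \<pi>' j < max (\<theta>' j) (\<theta>' (Suc j))"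
    by blast
  have inj': "\<And>i j. i < m \<Longrightarrow> j < m \<Longrightarrow> \<pi>' i = \<pi>' j \<Longrightarrow> i = j"
    using bij_betw_imp_inj_on[OF \<pi>'] by (auto simp: inj_on_def)
  have lt': "\<pi>' i < m" if "i < m" for i
    using bij_betwE[OF \<pi>'] that by auto
  \<comment> \<open>the gap that is assigned the topmost gap \<open>m\<close>; the other gaps take over the values of \<open>\<pi>'\<close>\<close>
  define t where "t = (if k = 0 then 0 else if k = Suc m then m
                       else if \<theta> (k - 1) < \<theta> (Suc k) then k else k - 1)"
  define \<pi> where "\<pi> j = (if j = t then m else \<pi>' (if j < t then j else j - 1))" for j
  have t: "t \<le> m" using k(1) by (auto simp: t_def)
  have ne: "\<pi> j < m" if "j \<le> m" "j \<noteq> t" for j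
    using that t by (auto simp: \<pi>_def intro!: lt')
  have "inj_on \<pi> {..<Suc m}"
  proof (rule inj_onI)
    fix i j assume ij: "i \<in> {..<Suc m}" "j \<in> {..<Suc m}" "\<pi> i = \<pi> j"
    show "i = j"
    proof (cases "i = t \<or> j = t")
      case True
      moreover have "\<pi> t = m" by (simp add: \<pi>_def)
      ultimately show ?thesis using ne[of i] ne[of j] ij by fastforce
    next
      case False
      then have "\<pi>' (if i < t then i else i - 1) = \<pi>' (if j < t then j else j - 1)"
        using ij(3) by (simp add: \<pi>_def)
      with t False ij have "(if i < t then i else i - 1) = (if j < t then j else j - 1)"
        by (intro inj'[of "if i < t then i else i - 1" "if j < t then j else j - 1"]) auto
      then show ?thesis using False by (auto split: if_splits)
    qed
  qed
  moreover have "\<pi> ` {..<Suc m} \<subseteq> {..<Suc m}"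
  proof
    fix x assume "x \<in> \<pi> ` {..<Suc m}"
    then obtain j where "j < Suc m" "x = \<pi> j" by auto
    then show "x \<in> {..<Suc m}" using ne[of j] by (cases "j = t") (auto simp: \<pi>_def)
  qed
  ultimately have "bij_betw \<pi> {..<Suc m} {..<Suc m}"
    by (simp add: bij_betw_def endo_inj_surj)
  moreover have "min (\<theta> j) (\<theta> (Suc j)) \<le> \<pi> j \<and> \<pi> j < max (\<theta> j) (\<theta> (Suc j))" if "j < Suc m" for j
  proof (cases "j = t")
    case True
    then have \<pi>: "\<pi> j = m" by (simp add: \<pi>_def)
    consider "j = k" "k \<le> m" | "Suc j = k"
      using True k(1) by (auto simp: t_def split: if_splits)
    then show ?thesis
    proof cases
      case 1
      then show ?thesis using \<pi> k lt[of "Suc j"] by auto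
    next
      case 2
      then show ?thesis using \<pi> k lt[of j] by auto
    qed
  next
    case False
    define i where "i = (if j < t then j else j - 1)"
    have i: "i < m" using that t False by (auto simp: i_def)
    have \<pi>: "\<pi> j = \<pi>' i" using False by (simp add: \<pi>_def i_def)
    consider "Suc j < k" | "k < j" | "Suc j = k" | "j = k" by linarith
    then show ?thesis
    proof cases
      case 1
      then have "i = j" using k by (auto simp: i_def t_def split: if_splits)
      then show ?thesis using cov[OF i] 1 \<pi> by (simp add: \<theta>'_def)
    next
      case 2
      then have "j = Suc i" using k that by (auto simp: i_def t_def split: if_splits)
      then show ?thesis using cov[OF i] 2 \<pi> by (simp add: \<theta>'_def)
    next
      case 3
      then have *: "k \<le> m" "\<theta> (k - 1) < \<theta> (Suc k)" "t = k"
        using False k(1) by (auto simp: t_def split: if_splits)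
      then have "i = j" using 3 by (auto simp: i_def)
      then show ?thesis using cov[OF i] 3 * \<pi> lt[of "Suc k"] k lt'[OF i] by (auto simp: \<theta>'_def)
    next
      case 4
      then have *: "0 < k" "k \<le> m" "\<not> \<theta> (k - 1) < \<theta> (Suc k)" "t = k - 1"
        using False k(1) that by (auto simp: t_def split: if_splits)
      then have "j = Suc i" using 4 by (auto simp: i_def)
      then show ?thesis using cov[OF i] 4 * \<pi> k lt'[OF i] by (auto simp: \<theta>'_def)
    qed
  qed
  ultimately show ?case by blast
qed

lemma prod_ge_factor:
  fixes r :: "'a \<Rightarrow> real"
  assumes "finite A" "a \<in> A" "\<And>x. x \<in> A \<Longrightarrow> 1 \<le> r x"
  shows "r a \<le> prod r A"
proof -
  have "prod r A = r a * prod r (A - {a})" using assms by (intro prod.remove) auto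
  moreover have "1 \<le> prod r (A - {a})" using assms by (intro prod_ge_1) auto
  moreover have "0 < r a" using assms(2,3) by fastforce
  ultimately show ?thesis by simp
qed

text \<open>
  Row \<open>i\<close> stands for the gaps inside the \<open>i\<close>-th interval of a cycle of length \<open>q\<close>, with
  lengths \<open>v i j\<close> and slopes \<open>s i j\<close>; the image of gap \<open>j\<close> covers the gaps \<open>A i j\<close> of the
  next row. The lengths cancel in the product of the ratios \<open>r\<close> of image to assigned gap,
  which is therefore \<open>T\<close>, and all these ratios are at least one. The product of the ratios
  \<open>w\<close> along the loop \<open>e\<close> is \<open>1 / \<sigma>\<close>. If the loop left the bijection, one image would contain
  both the next gap of the loop and the assigned gap, with proportions at least \<open>1 / \<sigma>\<close> and
  \<open>1 / T\<close>; these sum to more than one when \<open>\<sigma> * (T - 1) < T\<close>.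
\<close>

lemma loop_of_covered_gaps:
  fixes v s :: "nat \<Rightarrow> nat \<Rightarrow> real"
  assumes v: "\<And>i j. j < m \<Longrightarrow> 0 < v i j" and vq: "\<And>j. v q j = v 0 j"
    and s: "\<And>i j. j < m \<Longrightarrow> 0 < s i j"
    and A: "\<And>i j. j < m \<Longrightarrow> A i j \<subseteq> {..<m}"
    and cover: "\<And>i j. j < m \<Longrightarrow> (\<Sum>k\<in>A i j. v (Suc i) k) \<le> s i j * v i j"
    and \<pi>: "\<And>i. bij_betw (\<pi> i) {..<m} {..<m}" and \<pi>A: "\<And>i j. j < m \<Longrightarrow> \<pi> i j \<in> A i j"
    and e: "\<And>i. e i < m" "e q = e 0" "\<And>i. e (Suc i) \<in> A i (e i)"
  defines "T \<equiv> \<Prod>i<q. \<Prod>j<m. s i j" and "\<sigma> \<equiv> \<Prod>i<q. s i (e i)"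
  shows "1 \<le> T" and "1 \<le> \<sigma>" and "\<sigma> * (T - 1) < T \<Longrightarrow> \<sigma> \<le> T"
    and "T = 1 \<Longrightarrow> i < q \<Longrightarrow> s i (e i) * v i (e i) = v (Suc i) (e (Suc i))"
proof -
  define r where "r i j = s i j * v i j / v (Suc i) (\<pi> i j)" for i j
  define w where "w i = v (Suc i) (e (Suc i)) / (s i (e i) * v i (e i))" for i
  have sv: "0 < s i j * v i j" if "j < m" for i j using v s that by simp
  have \<pi>m: "\<pi> i j < m" if "j < m" for i j using bij_betwE[OF \<pi>] that by auto
  have fin: "finite (A i j)" if "j < m" for i j using A[OF that] finite_subset by blast
  have sub: "(\<Sum>k\<in>B. v (Suc i) k) \<le> s i j * v i j" if "j < m" "B \<subseteq> A i j" for i j B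
  proof -
    have "(\<Sum>k\<in>B. v (Suc i) k) \<le> (\<Sum>k\<in>A i j. v (Suc i) k)"
      using that A[OF that(1)] fin[OF that(1)] by (intro sum_mono2) (auto intro!: less_imp_le[OF v])
    with cover[OF that(1), of i] show ?thesis by linarith
  qed
  have r1: "1 \<le> r i j" if "j < m" for i j
    using sub[OF that, of "{\<pi> i j}"] \<pi>A[OF that] v[OF \<pi>m[OF that]] by (simp add: r_def)
  have w1: "w i \<le> 1" and w0: "0 < w i" for i
    using sub[OF e(1), of "{e (Suc i)}" i] e(3)[of i] sv[OF e(1)] v[OF e(1)] by (auto simp: w_def)
  have tele: "(\<Prod>i<n. V (Suc i)) * V 0 = (\<Prod>i<n. V i) * V n" for n and V :: "nat \<Rightarrow> real"
    by (induction n) (auto simp: algebra_simps)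
  have shift: "(\<Prod>i<q. V (Suc i)) = (\<Prod>i<q. V i)" if "V 0 \<noteq> 0" "V q = V 0" for V :: "nat \<Rightarrow> real"
    using tele[where n = q and V = V] that by simp
  have Tr: "(\<Prod>i<q. \<Prod>j<m. r i j) = T"
  proof -
    have "(\<Prod>j<m. v (Suc i) (\<pi> i j)) = (\<Prod>j<m. v (Suc i) j)" for i
      by (rule prod.reindex_bij_betw[OF \<pi>])
    then have "(\<Prod>i<q. \<Prod>j<m. r i j)
        = (\<Prod>i<q. \<Prod>j<m. s i j) * (\<Prod>i<q. \<Prod>j<m. v i j) / (\<Prod>i<q. \<Prod>j<m. v (Suc i) j)"
      by (simp add: r_def prod_dividef prod.distrib)
    also have "(\<Prod>i<q. \<Prod>j<m. v (Suc i) j) = (\<Prod>i<q. \<Prod>j<m. v i j)"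
      using v vq by (intro shift) (auto simp: less_imp_neq[OF v, symmetric])
    also have "(\<Prod>i<q. \<Prod>j<m. v i j) \<noteq> 0"
      by (auto simp: less_imp_neq[OF v, symmetric])
    ultimately show ?thesis by (simp add: T_def)
  qed
  have r_row: "r i j \<le> (\<Prod>j<m. r i j)" if "j < m" for i j
    using r1 that by (intro prod_ge_factor) auto
  have row1: "1 \<le> (\<Prod>j<m. r i j)" for i using r1 by (intro prod_ge_1) auto
  show T1: "1 \<le> T" unfolding Tr[symmetric] by (intro prod_ge_1 row1)
  have rT: "r i j \<le> T" if "i < q" "j < m" for i j
  proof -
    have "(\<Prod>j<m. r i j) \<le> (\<Prod>i<q. \<Prod>j<m. r i j)"
      using that row1 by (intro prod_ge_factor[where r = "\<lambda>i. \<Prod>j<m. r i j"]) auto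
    then show ?thesis using r_row[OF that(2), of i] Tr by linarith
  qed
  have w\<sigma>: "(\<Prod>i<q. w i) = 1 / \<sigma>"
  proof -
    have nz: "(\<Prod>i<q. v i (e i)) \<noteq> 0" using v[OF e(1)] by (auto simp: less_imp_neq[symmetric])
    have "(\<Prod>i<q. v (Suc i) (e (Suc i))) = (\<Prod>i<q. v i (e i))"
      using v[OF e(1), of 0 0] e(2) vq by (intro shift) auto
    then show ?thesis using nz by (simp add: w_def \<sigma>_def prod_dividef prod.distrib)
  qed
  have \<sigma>0: "0 < \<sigma>" unfolding \<sigma>_def using s[OF e(1)] by (intro prod_pos) auto
  have "(\<Prod>i<q. w i) \<le> 1" using w1 w0 by (intro prod_le_1) (auto simp: less_imp_le)
  then show "1 \<le> \<sigma>" using w\<sigma> \<sigma>0 by (simp add: field_simps)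
  have w_ge: "1 / \<sigma> \<le> w i" if "i < q" for i
  proof -
    have "(\<Prod>i<q. w i) = w i * (\<Prod>i\<in>{..<q} - {i}. w i)" using that by (intro prod.remove) auto
    moreover have "(\<Prod>i\<in>{..<q} - {i}. w i) \<le> 1"
      using w1 w0 by (intro prod_le_1) (auto simp: less_imp_le)
    ultimately show ?thesis using w\<sigma> w0[of i] by (simp add: mult_left_le)
  qed
  have forced: "e (Suc i) = \<pi> i (e i)" if "\<sigma> * (T - 1) < T" "i < q" for i
  proof (rule ccontr)
    assume ne: "e (Suc i) \<noteq> \<pi> i (e i)"
    let ?x = "s i (e i) * v i (e i)"
    have "v (Suc i) (e (Suc i)) + v (Suc i) (\<pi> i (e i)) \<le> ?x"
      using sub[OF e(1), of "{e (Suc i), \<pi> i (e i)}" i] ne e(3) \<pi>A[OF e(1)] by simp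
    then have "w i + 1 / r i (e i) \<le> 1"
      using sv[OF e(1)] by (simp add: w_def r_def add_divide_distrib[symmetric])
    moreover have "1 / T \<le> 1 / r i (e i)"
      using rT[OF that(2) e(1), of i] r1[OF e(1), of i i] T1 by (intro divide_left_mono mult_pos_pos) auto
    ultimately have "1 / \<sigma> + 1 / T \<le> 1" using w_ge[OF that(2)] by linarith
    then have "T + \<sigma> \<le> \<sigma> * T" using \<sigma>0 T1 by (simp add: field_simps)
    then show False using that(1) by (simp add: algebra_simps)
  qed
  {
    assume *: "\<sigma> * (T - 1) < T"
    have "\<sigma> = 1 / (\<Prod>i<q. w i)" using w\<sigma> \<sigma>0 by simp
    also have "\<dots> = (\<Prod>i<q. r i (e i))"
      using forced[OF *] by (simp add: prod_dividef w_def r_def prod.distrib)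
    also have "\<dots> \<le> (\<Prod>i<q. \<Prod>j<m. r i j)"
      using r_row[OF e(1)] r1[OF e(1)] by (intro prod_mono) (auto intro: order_trans[OF zero_le_one])
    finally show "\<sigma> \<le> T" using Tr by simp
  }
  {
    assume "T = 1" "i < q"
    then have "r i (e i) = 1" "e (Suc i) = \<pi> i (e i)"
      using rT[OF _ e(1), of i i] r1[OF e(1), of i i] forced by auto
    then show "s i (e i) * v i (e i) = v (Suc i) (e (Suc i))"
      using v[OF e(1), of "Suc i" "Suc i"] by (simp add: r_def field_simps)
  }
qed

section \<open>Cycles and their refinements\<close>

lemma cycle_indexed:
  assumes "is_cycle f C"
  obtains q :: nat and I where "q \<ge> 1" "C = I ` {..<q}"
    "\<forall>i<q. \<exists>a b. 0 \<le> a \<and> a \<le> b \<and> b \<le> 1 \<and> I i = {a..b}"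
    "disjoint_family_on I {..<q}" "\<forall>i<q. f ` I i \<subseteq> I ((i + 1) mod q)"
proof -
  from assms obtain q :: nat and I where *: "q \<ge> 1 \<and> C = I ` {..<q} \<and>
      (\<forall>i<q. \<exists>a b. 0 \<le> a \<and> a \<le> b \<and> b \<le> 1 \<and> I i = {a..b}) \<and>
      disjoint_family_on I {..<q} \<and> (\<forall>i<q. f ` I i \<subseteq> I ((i + 1) mod q))"
    unfolding is_cycle_def by (elim exE)
  show thesis by (rule that[of q I]) (use * in simp_all)
qed

lemma cycle_interval:
  assumes "is_cycle f C" "X \<in> C"
  obtains a b where "0 \<le> a" "a \<le> b" "b \<le> 1" "X = {a..b}"
proof -
  obtain q :: nat and I where I: "C = I ` {..<q}"
      "\<forall>i<q. \<exists>a b. 0 \<le> a \<and> a \<le> b \<and> b \<le> 1 \<and> I i = {a..b}"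
    by (rule cycle_indexed[OF assms(1)], rule that)
  then obtain i where "i < q" "X = I i" using assms(2) by auto
  with I(2) obtain a b where "0 \<le> a" "a \<le> b" "b \<le> 1" "X = {a..b}" by auto
  then show thesis by (rule that)
qed

lemma cycle_finite: "is_cycle f C \<Longrightarrow> finite C"
  by (erule cycle_indexed) simp

lemma cycle_disjoint:
  assumes "is_cycle f C" "X \<in> C" "Y \<in> C" "x \<in> X" "x \<in> Y"
  shows "X = Y"
proof -
  obtain q :: nat and I where I: "C = I ` {..<q}" "disjoint_family_on I {..<q}"
    by (rule cycle_indexed[OF assms(1)], rule that)
  then obtain i j where ij: "i < q" "j < q" "X = I i" "Y = I j" using assms(2,3) by auto
  have "i = j"
  proof (rule ccontr)
    assume "i \<noteq> j"
    then have "I i \<inter> I j = {}" using I(2) ij by (auto simp: disjoint_family_on_def)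
    with assms(4,5) ij show False by auto
  qed
  with ij show ?thesis by simp
qed

lemma cycle_nonempty: "is_cycle f C \<Longrightarrow> C \<noteq> {}"
  by (erule cycle_indexed) (simp add: lessThan_empty_iff)

lemma cycle_nonempty_member: "is_cycle f C \<Longrightarrow> X \<in> C \<Longrightarrow> X \<noteq> {}"
  by (elim cycle_interval) auto

lemma mod_eq_shift:
  fixes i j k q :: nat
  shows "(i + k) mod q = (j + k) mod q \<longleftrightarrow> i mod q = j mod q"
proof -
  have "int ((i + k) mod q) = int ((j + k) mod q) \<longleftrightarrow> int (i mod q) = int (j mod q)"
    by (simp add: zmod_int mod_eq_dvd_iff)
  then show ?thesis by simp
qed

text \<open>
  Indexing by all natural numbers, periodically, avoids remainders in the dynamics: the image
  of interval \<open>i\<close> lies in interval \<open>Suc i\<close>.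
\<close>

lemma cycle_enumeration:
  assumes C: "is_cycle f C" and X: "X \<in> C"
  obtains I :: "nat \<Rightarrow> real set" where "range I = C" "I 0 = X" "\<forall>i. f ` I i \<subseteq> I (Suc i)"
    "\<forall>i j. I i = I j \<longleftrightarrow> i mod card C = j mod card C" "card C > 0" "bij_betw I {..<card C} C"
proof -
  obtain q :: nat and I where q: "q \<ge> 1" "C = I ` {..<q}"
    and ivl: "\<forall>i<q. \<exists>a b. 0 \<le> a \<and> a \<le> b \<and> b \<le> 1 \<and> I i = {a..b}"
    and dis: "disjoint_family_on I {..<q}" and img: "\<forall>i<q. f ` I i \<subseteq> I ((i + 1) mod q)"
    by (rule cycle_indexed[OF C], rule that)
  have ne: "I i \<noteq> {}" if "i < q" for i using ivl[rule_format, OF that] by auto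
  have inj: "inj_on I {..<q}"
  proof (rule inj_onI, rule ccontr)
    fix i j assume "i \<in> {..<q}" "j \<in> {..<q}" "I i = I j" "i \<noteq> j"
    then show False using dis ne[of i] unfolding disjoint_family_on_def by auto
  qed
  then have card: "card C = q" using q(2) by (simp add: card_image)
  obtain i0 where i0: "i0 < q" "X = I i0" using X q(2) by auto
  define K where "K i = I ((i + i0) mod q)" for i
  have K_eq: "K i = K j \<longleftrightarrow> i mod q = j mod q" for i j
  proof -
    have "K i = K j \<longleftrightarrow> (i + i0) mod q = (j + i0) mod q"
      using inj q(1) by (auto simp: K_def inj_on_def)
    then show ?thesis by (simp add: mod_eq_shift)
  qed
  have K_in: "K i \<in> C" for i using q by (auto simp: K_def)
  have K_inj: "inj_on K {..<q}" by (auto simp: inj_on_def K_eq)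
  have "card (K ` {..<q}) = card C" using K_inj card by (simp add: card_image)
  then have K_img: "K ` {..<q} = C"
    using K_in cycle_finite[OF C] by (intro card_subset_eq) auto
  show thesis
  proof
    show "range K = C" using K_img K_in by auto
    show "K 0 = X" using i0 by (simp add: K_def)
    show "\<forall>i. f ` K i \<subseteq> K (Suc i)"
    proof
      show "f ` K i \<subseteq> K (Suc i)" for i
        using img[rule_format, of "(i + i0) mod q"] q(1) by (simp add: K_def mod_Suc_eq)
    qed
    show "\<forall>i j. K i = K j \<longleftrightarrow> i mod card C = j mod card C" by (simp add: K_eq card)
    show "card C > 0" using q(1) card by simp
    show "bij_betw K {..<card C} C" using K_inj K_img card by (simp add: bij_betw_def)
  qed
qed

text \<open>
  An interval is connected, and the intervals of \<open>C\<close> are closed and disjoint.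
\<close>

lemma subcycle_member:
  assumes C: "is_cycle f C" and D: "is_cycle f D" and sub: "\<Union>D \<subseteq> \<Union>C" and Y: "Y \<in> D"
  obtains X where "X \<in> C" "Y \<subseteq> X"
proof -
  obtain y where y: "y \<in> Y" using cycle_nonempty_member[OF D Y] by auto
  then obtain X where X: "X \<in> C" "y \<in> X" using sub Y by blast
  have closed: "closed Z" if "Z \<in> C" for Z using that by (elim cycle_interval[OF C]) auto
  have "connected Y" using Y by (elim cycle_interval[OF D]) auto
  moreover have "closed X" "closed (\<Union>(C - {X}))"
    using X closed cycle_finite[OF C] by (auto intro!: closed_Union)
  moreover have "X \<inter> \<Union>(C - {X}) \<inter> Y = {}" using cycle_disjoint[OF C X(1)] by blast
  moreover have "Y \<subseteq> X \<union> \<Union>(C - {X})" using sub Y X by blast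
  ultimately have "X \<inter> Y = {} \<or> \<Union>(C - {X}) \<inter> Y = {}" by (intro connected_closedD)
  with y X have "\<Union>(C - {X}) \<inter> Y = {}" by blast
  with sub Y have "Y \<subseteq> X" by blast
  with X that show thesis by blast
qed

lemma card_subcycle:
  assumes C: "is_cycle f C" and D: "is_cycle f D" and sub: "\<Union>D \<subseteq> \<Union>C" and "A \<subseteq> C"
    and m: "\<And>X. X \<in> A \<Longrightarrow> card {Y \<in> D. Y \<subseteq> X} = m"
  shows "card {Y \<in> D. \<exists>X\<in>A. Y \<subseteq> X} = m * card A"
proof -
  have "{Y \<in> D. \<exists>X\<in>A. Y \<subseteq> X} = (\<Union>X\<in>A. {Y \<in> D. Y \<subseteq> X})" by blast
  also have "card \<dots> = (\<Sum>X\<in>A. card {Y \<in> D. Y \<subseteq> X})"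
  proof (intro card_UN_disjoint ballI impI)
    show "finite A" using \<open>A \<subseteq> C\<close> cycle_finite[OF C] finite_subset by blast
    show "finite {Y \<in> D. Y \<subseteq> X}" for X using cycle_finite[OF D] by simp
    fix X X' assume "X \<in> A" "X' \<in> A" "X \<noteq> X'"
    then show "{Y \<in> D. Y \<subseteq> X} \<inter> {Y \<in> D. Y \<subseteq> X'} = {}"
      using cycle_disjoint[OF C, of X X'] cycle_nonempty_member[OF D] \<open>A \<subseteq> C\<close> by blast
  qed
  finally show ?thesis using m by simp
qed

text \<open>
  Two refinements in a row multiply the period by at least four, while a single one may only
  double it.
\<close>

lemma refinement_step_twice:
  assumes C: "is_cycle f C" and D: "is_cycle f D" and E: "is_cycle f E"
    and r1: "cycle_refines D C" and r2: "cycle_refines E D"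
  shows "\<Union>E \<subseteq> \<Union>C" and "\<exists>m\<ge>3. \<forall>X\<in>C. card {Z \<in> E. Z \<subseteq> X} = m"
proof -
  obtain a where a: "a \<ge> 2" "\<And>X. X \<in> C \<Longrightarrow> card {Y \<in> D. Y \<subseteq> X} = a" and DC: "\<Union>D \<subseteq> \<Union>C"
    using r1 unfolding cycle_refines_def by blast
  obtain b where b: "b \<ge> 2" "\<And>Y. Y \<in> D \<Longrightarrow> card {Z \<in> E. Z \<subseteq> Y} = b" and ED: "\<Union>E \<subseteq> \<Union>D"
    using r2 unfolding cycle_refines_def by blast
  show "\<Union>E \<subseteq> \<Union>C" using ED DC by blast
  have "card {Z \<in> E. Z \<subseteq> X} = b * a" if X: "X \<in> C" for X
  proof -
    have "Z \<subseteq> X \<longleftrightarrow> (\<exists>Y\<in>{Y \<in> D. Y \<subseteq> X}. Z \<subseteq> Y)" if Z: "Z \<in> E" for Z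
    proof
      assume "Z \<subseteq> X"
      obtain Y where Y: "Y \<in> D" "Z \<subseteq> Y" using subcycle_member[OF D E ED Z] .
      obtain X' where X': "X' \<in> C" "Y \<subseteq> X'" using subcycle_member[OF C D DC Y(1)] .
      have "X' = X"
        using cycle_disjoint[OF C X'(1) X] cycle_nonempty_member[OF E Z] \<open>Z \<subseteq> X\<close> Y X' by blast
      with X' Y show "\<exists>Y\<in>{Y \<in> D. Y \<subseteq> X}. Z \<subseteq> Y" by blast
    qed blast
    then have "{Z \<in> E. Z \<subseteq> X} = {Z \<in> E. \<exists>Y\<in>{Y \<in> D. Y \<subseteq> X}. Z \<subseteq> Y}" by blast
    also have "card \<dots> = b * card {Y \<in> D. Y \<subseteq> X}"
      using b by (intro card_subcycle[OF D E ED]) auto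
    finally show ?thesis using a X by simp
  qed
  moreover have "b * a \<ge> 3" using mult_le_mono[OF a(1) b(1)] by (simp add: mult.commute)
  ultimately show "\<exists>m\<ge>3. \<forall>X\<in>C. card {Z \<in> E. Z \<subseteq> X} = m" by blast
qed

lemma refined_nondegenerate:
  assumes C: "is_cycle f C" and D: "is_cycle f D" and X: "X \<in> C"
    and m: "card {Y \<in> D. Y \<subseteq> X} \<ge> 2"
  shows "Inf X < Sup X"
proof -
  obtain a b where ab: "a \<le> b" "X = {a..b}" using X by (elim cycle_interval[OF C])
  have "\<not> card {Y \<in> D. Y \<subseteq> X} \<le> Suc 0" using m by simp
  then have "\<not> (\<forall>Y\<in>{Y \<in> D. Y \<subseteq> X}. \<forall>Z\<in>{Y \<in> D. Y \<subseteq> X}. Y = Z)"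
    using card_le_Suc0_iff_eq[of "{Y \<in> D. Y \<subseteq> X}"] cycle_finite[OF D] by simp
  then obtain Y Z where YZ: "Y \<in> D" "Z \<in> D" "Y \<noteq> Z" "Y \<subseteq> X" "Z \<subseteq> X" by auto
  obtain y z where yz: "y \<in> Y" "z \<in> Z" using YZ cycle_nonempty_member[OF D] by blast
  then have "y \<noteq> z" using cycle_disjoint[OF D YZ(1,2)] YZ(3) by blast
  moreover have "y \<in> {a..b}" "z \<in> {a..b}" using YZ yz ab by auto
  ultimately have "a < b" by auto
  then show ?thesis using ab by simp
qed

lemma ordered_enumeration:
  fixes S :: "real set set"
  assumes "finite S" and "\<And>X. X \<in> S \<Longrightarrow> \<exists>a b. a \<le> b \<and> X = {a..b}"
    and "\<And>X Y x. X \<in> S \<Longrightarrow> Y \<in> S \<Longrightarrow> x \<in> X \<Longrightarrow> x \<in> Y \<Longrightarrow> X = Y"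
  shows "\<exists>L R. S = (\<lambda>j. {L j..R j}) ` {..<card S} \<and> (\<forall>j<card S. L j \<le> R j) \<and>
           (\<forall>j. Suc j < card S \<longrightarrow> R j < L (Suc j))"
  using assms
proof (induction "card S" arbitrary: S)
  case 0
  then show ?case by simp
next
  case (Suc n)
  then have fin: "finite S" and ne: "S \<noteq> {}" by auto
  have "Max (Inf ` S) \<in> Inf ` S" using fin ne by (intro Max_in) auto
  then obtain M where M: "M \<in> S" "Inf M = Max (Inf ` S)" by auto
  have M_max: "Inf X \<le> Inf M" if "X \<in> S" for X using that fin M(2) by simp
  obtain a b where ab: "a \<le> b" "M = {a..b}" using Suc.prems(2)[OF M(1)] by blast
  have card: "card (S - {M}) = n" using M fin Suc.hyps(2) by simp
  obtain L R where LR: "S - {M} = (\<lambda>j. {L j..R j}) ` {..<n}" "\<And>j. j < n \<Longrightarrow> L j \<le> R j"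
      "\<And>j. Suc j < n \<Longrightarrow> R j < L (Suc j)"
    using Suc.hyps(1)[of "S - {M}"] Suc.prems card by (auto simp: card)
  have below: "R j < a" if "j < n" for j
  proof -
    have X: "{L j..R j} \<in> S - {M}" unfolding LR(1) using that by blast
    then have "L j \<le> a" using M_max[of "{L j..R j}"] LR(2)[OF that] ab by simp
    moreover have "a \<notin> {L j..R j}" using X Suc.prems(3)[OF M(1), of "{L j..R j}" a] ab by auto
    ultimately show ?thesis by auto
  qed
  have "S = insert M (S - {M})" using M by blast
  also have "\<dots> = (\<lambda>j. {(L(n := a)) j..(R(n := b)) j}) ` {..<Suc n}"
    unfolding LR(1) lessThan_Suc image_insert using ab by (auto intro!: image_cong)
  finally have "S = (\<lambda>j. {(L(n := a)) j..(R(n := b)) j}) ` {..<card S}" using Suc.hyps(2) by simp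
  moreover have "\<forall>j<card S. (L(n := a)) j \<le> (R(n := b)) j"
    using LR(2) ab Suc.hyps(2) by (auto simp: less_Suc_eq)
  moreover have "\<forall>j. Suc j < card S \<longrightarrow> (R(n := b)) j < (L(n := a)) (Suc j)"
    using LR(3) below Suc.hyps(2) by (auto simp: less_Suc_eq)
  ultimately show ?case by blast
qed

section \<open>Maps with finitely many slopes\<close>

text \<open>
  Only the modulus \<open>sl\<close> of the slope off the breakpoints \<open>P\<close> is recorded, because lengths are
  compared throughout; orientation is read off from the values of \<open>f\<close>.
\<close>

locale affine_pieces =
  fixes f sl :: "real \<Rightarrow> real" and P :: "real set"
  assumes continuous: "continuous_on {0..1} f" and into_unit: "f ` {0..1} \<subseteq> {0..1}"
    and finite_P: "finite P" and finite_slopes: "finite (sl ` ({0..1} - P))"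
    and slope_pos: "x \<in> {0..1} - P \<Longrightarrow> 0 < sl x"
    and slope: "0 \<le> u \<Longrightarrow> v \<le> 1 \<Longrightarrow> {u<..<v} \<inter> P = {} \<Longrightarrow> z \<in> {u<..<v} \<Longrightarrow>
                x \<in> {u..v} \<Longrightarrow> y \<in> {u..v} \<Longrightarrow> \<bar>f x - f y\<bar> = sl z * \<bar>x - y\<bar>"
begin

lemma slope_cong:
  assumes "0 \<le> u" "v \<le> 1" "{u<..<v} \<inter> P = {}" "z \<in> {u<..<v}" "w \<in> {u<..<v}"
  shows "sl z = sl w"
proof -
  have "u < v" using assms(4) by simp
  then have "sl z * \<bar>u - v\<bar> = sl w * \<bar>u - v\<bar>"
    using slope[OF assms(1-4), of u v] slope[OF assms(1-3,5), of u v] by simp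
  with \<open>u < v\<close> show ?thesis by simp
qed

text \<open>
  Distances in the segment are scaled by one factor, so the triangle inequality is an
  equality for the images as well.
\<close>

lemma between_endpoints:
  assumes "0 \<le> u" "v \<le> 1" "{u<..<v} \<inter> P = {}" "u < x" "x < v"
  shows "min (f u) (f v) \<le> f x" "f x \<le> max (f u) (f v)"
proof -
  have x: "x \<in> {u<..<v}" using assms by simp
  have "\<bar>f x - f u\<bar> = sl x * (x - u)" "\<bar>f v - f x\<bar> = sl x * (v - x)" "\<bar>f v - f u\<bar> = sl x * (v - u)"
    using slope[OF assms(1-3) x] assms(4,5) by simp_all
  then have "\<bar>f x - f u\<bar> + \<bar>f v - f x\<bar> = \<bar>f v - f u\<bar>" by (simp add: algebra_simps)
  then show "min (f u) (f v) \<le> f x" "f x \<le> max (f u) (f v)" by linarith+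
qed

lemma iterate_unit:
  shows "continuous_on {0..1} (f ^^ n)" and "(f ^^ n) ` {0..1} \<subseteq> {0..1}"
proof (induction n)
  case (Suc n)
  case 1
  show ?case
    using continuous_on_compose[OF Suc(1) continuous_on_subset[OF continuous Suc(2)]] by (simp add: comp_def)
next
  case (Suc n)
  case 2
  have "(f ^^ Suc n) ` {0..1} = f ` (f ^^ n) ` {0..1}" by (simp add: image_comp)
  also have "\<dots> \<subseteq> {0..1}" using Suc(2) into_unit by fast
  finally show ?case .
qed auto

lemma slope_lower_bound: "\<exists>\<kappa>. 0 < \<kappa> \<and> \<kappa> \<le> 1 \<and> (\<forall>x\<in>{0..1} - P. \<kappa> \<le> sl x)"
proof -
  let ?S = "insert 1 (sl ` ({0..1} - P))"
  have "finite ?S" using finite_slopes by simp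
  moreover from this have "Min ?S \<in> ?S" by (rule Min_in) simp
  ultimately show ?thesis
    using slope_pos by (intro exI[of _ "Min ?S"]) auto
qed

text \<open>
  Folding at breakpoints can shorten the image of a segment at most by a factor depending on
  the number of breakpoints in it: the bound is additive when the segment is cut at a
  breakpoint.
\<close>

lemma length_le_spread:
  fixes \<kappa> u v W :: real
  assumes \<kappa>: "0 < \<kappa>" "\<And>x. x \<in> {0..1} - P \<Longrightarrow> \<kappa> \<le> sl x"
    and "0 \<le> u" "u \<le> v" "v \<le> 1" and W: "\<And>x y. x \<in> {u..v} \<Longrightarrow> y \<in> {u..v} \<Longrightarrow> \<bar>f x - f y\<bar> \<le> W"
  shows "\<kappa> * (v - u) \<le> (card (P \<inter> {u<..<v}) + 1) * W"
  using assms(3-)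
proof (induction "card (P \<inter> {u<..<v})" arbitrary: u v rule: less_induct)
  case less
  have W0: "0 \<le> W" using less.prems(4)[of u u] less.prems(2) by simp
  show ?case
  proof (cases "P \<inter> {u<..<v} = {}")
    case True
    show ?thesis
    proof (cases "u < v")
      case lt: True
      define z where "z = (u + v) / 2"
      have z: "z \<in> {u<..<v}" using lt by (simp add: z_def)
      then have "z \<in> {0..1} - P" using True less.prems by auto
      then have "\<kappa> * (v - u) \<le> sl z * (v - u)" using \<kappa>(2) lt by (intro mult_right_mono) auto
      also have "\<dots> = \<bar>f u - f v\<bar>"
        using slope[OF less.prems(1,3), of z u v] True z lt by (auto simp: Int_commute)
      also have "\<dots> \<le> W" using less.prems by auto
      finally show ?thesis using True by simp
    qed (use less.prems W0 in auto)
  next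
    case False
    then obtain p where p: "p \<in> P" "u < p" "p < v" by auto
    let ?A = "P \<inter> {u<..<p}" and ?B = "P \<inter> {p<..<v}"
    have split: "P \<inter> {u<..<v} = insert p (?A \<union> ?B)" using p by auto
    have "card (P \<inter> {u<..<v}) = Suc (card (?A \<union> ?B))"
      unfolding split using finite_P by (intro card_insert_disjoint) auto
    moreover have "card (?A \<union> ?B) = card ?A + card ?B"
      using finite_P by (intro card_Un_disjoint) auto
    ultimately have card: "card (P \<inter> {u<..<v}) = card ?A + card ?B + 1" by simp
    have "\<kappa> * (p - u) \<le> (card ?A + 1) * W" "\<kappa> * (v - p) \<le> (card ?B + 1) * W"
      by (rule less.hyps; use less.prems p card in auto)+
    then have "\<kappa> * (v - u) \<le> (card ?A + 1) * W + (card ?B + 1) * W"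
      by (simp add: algebra_simps)
    also have "\<dots> = (card (P \<inter> {u<..<v}) + 1) * W" by (simp add: card algebra_simps)
    finally show ?thesis .
  qed
qed

text \<open>
  The midpoint represents an interval without breakpoints, on which \<open>sl\<close> is constant.
  Intervals with breakpoints get the value one, so that they do not contribute to the product
  \<open>expansion\<close>.
\<close>

definition mid_slope :: "real set \<Rightarrow> real" where
  "mid_slope X = (if X \<inter> P = {} then sl ((Inf X + Sup X) / 2) else 1)"

definition expansion :: "real set set \<Rightarrow> real" where
  "expansion C = (\<Prod>X\<in>C. mid_slope X)"

lemma card_breaking:
  assumes C: "is_cycle f C"
  shows "card {X \<in> C. X \<inter> P \<noteq> {}} \<le> card P"
proof -
  define c where "c X = (SOME x. x \<in> X \<inter> P)" for X
  have c: "c X \<in> X \<inter> P" if "X \<inter> P \<noteq> {}" for X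
    unfolding c_def some_in_eq using that .
  have "inj_on c {X \<in> C. X \<inter> P \<noteq> {}}"
  proof (rule inj_onI)
    fix X Y assume X: "X \<in> {X \<in> C. X \<inter> P \<noteq> {}}" and Y: "Y \<in> {X \<in> C. X \<inter> P \<noteq> {}}"
      and eq: "c X = c Y"
    have "c X \<in> X" "c X \<in> Y" using X Y c[of X] c[of Y] unfolding eq by simp_all
    then show "X = Y" using X Y by (intro cycle_disjoint[OF C, of X Y "c X"]) simp_all
  qed
  moreover have "c ` {X \<in> C. X \<inter> P \<noteq> {}} \<subseteq> P" using c by fast
  ultimately show ?thesis by (rule card_inj_on_le[OF _ _ finite_P])
qed

lemma mid_slope_pos: "is_cycle f C \<Longrightarrow> X \<in> C \<Longrightarrow> 0 < mid_slope X"
proof -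
  assume C: "is_cycle f C" "X \<in> C"
  obtain a b where X: "0 \<le> a" "a \<le> b" "b \<le> 1" "X = {a..b}" by (rule cycle_interval[OF C])
  then have "(a + b) / 2 \<in> X" "(a + b) / 2 \<in> {0..1}" by auto
  with X show ?thesis by (auto simp: mid_slope_def intro!: slope_pos)
qed

lemma expansion_pos: "is_cycle f C \<Longrightarrow> 0 < expansion C"
  unfolding expansion_def by (intro prod_pos) (auto simp: mid_slope_pos)

text \<open>
  Going once around the cycle returns to the same length, so the factors by which the
  intervals grow have product one. Each factor is at least the slope on an interval without
  breakpoints and at least \<open>\<kappa>\<close> on the others, of which there are at most \<open>card P\<close>.
\<close>

lemma expansion_bounded:
  "\<exists>B. \<forall>C. is_cycle f C \<longrightarrow> (\<forall>X\<in>C. Inf X < Sup X) \<longrightarrow> expansion C \<le> B"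
proof -
  obtain \<kappa>0 where \<kappa>0: "0 < \<kappa>0" "\<kappa>0 \<le> 1" "\<And>x. x \<in> {0..1} - P \<Longrightarrow> \<kappa>0 \<le> sl x"
    using slope_lower_bound by blast
  \<comment> \<open>the factor in \<open>length_le_spread\<close> for an interval with any number of breakpoints\<close>
  define \<kappa> where "\<kappa> = \<kappa>0 / (card P + 1)"
  have \<kappa>: "0 < \<kappa>" "\<kappa> \<le> 1" using \<kappa>0 by (auto simp: \<kappa>_def field_simps)
  have "expansion C \<le> (1 / \<kappa>) ^ card P" if C: "is_cycle f C" and nd: "\<forall>X\<in>C. Inf X < Sup X" for C
  proof -
    define k where "k X = (if X \<inter> P = {} then 1 else \<kappa>)" for X :: "real set"
    define len where "len X = Sup X - Inf X" for X :: "real set"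
    have len: "k X * mid_slope X * len X \<le> len Y" if XY: "X \<in> C" "Y \<in> C" "f ` X \<subseteq> Y" for X Y
    proof -
      obtain a b where X: "0 \<le> a" "a \<le> b" "b \<le> 1" "X = {a..b}"
        by (rule cycle_interval[OF C XY(1)])
      obtain c d where Y: "c \<le> d" "Y = {c..d}" by (rule cycle_interval[OF C XY(2)], rule that)
      have ab: "a < b" using nd XY(1) X by auto
      have spread: "\<bar>f x - f y\<bar> \<le> d - c" if "x \<in> {a..b}" "y \<in> {a..b}" for x y
      proof -
        have "f x \<in> {c..d}" "f y \<in> {c..d}" using XY(3) that unfolding X(4) Y(2) by blast+
        then show ?thesis by (auto simp: abs_le_iff)
      qed
      show ?thesis
      proof (cases "X \<inter> P = {}")
        case True
        have "{a<..<b} \<inter> P = {}" using True X by force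
        then have "\<bar>f a - f b\<bar> = mid_slope X * (b - a)"
          using slope[OF X(1,3), of "(a + b) / 2" a b] X ab True by (simp add: mid_slope_def)
        then show ?thesis using spread[of a b] ab X Y True by (simp add: k_def len_def)
      next
        case False
        have "card (P \<inter> {a<..<b}) \<le> card P" using finite_P by (intro card_mono) auto
        then have "(card (P \<inter> {a<..<b}) + 1) * (d - c) \<le> (card P + 1) * (d - c)"
          using Y by (intro mult_right_mono) auto
        moreover have "\<kappa>0 * (b - a) \<le> (card (P \<inter> {a<..<b}) + 1) * (d - c)"
          using length_le_spread[OF \<kappa>0(1,3) X(1,2,3) spread] by simp
        ultimately have "\<kappa>0 * (b - a) \<le> (card P + 1) * (d - c)" by linarith
        then have "\<kappa> * (b - a) \<le> d - c" by (simp add: \<kappa>_def field_simps)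
        then show ?thesis using X Y False by (simp add: k_def len_def mid_slope_def)
      qed
    qed
    obtain X0 where X0: "X0 \<in> C" using cycle_nonempty[OF C] by auto
    obtain I where I: "range I = C" "I 0 = X0" "\<forall>i. f ` I i \<subseteq> I (Suc i)"
      "\<forall>i j. I i = I j \<longleftrightarrow> i mod card C = j mod card C" "card C > 0" "bij_betw I {..<card C} C"
      by (rule cycle_enumeration[OF C X0], rule that)
    have I_in: "I i \<in> C" for i using I(1) by blast
    have len_pos: "0 < len (I i)" for i using nd I_in[of i] by (simp add: len_def)
    have iter: "(\<Prod>i<n. k (I i) * mid_slope (I i)) * len (I 0) \<le> len (I n)" for n
    proof (induction n)
      case (Suc n)
      have pos: "0 < k (I n) * mid_slope (I n)"
        using mid_slope_pos[OF C I_in[of n]] \<kappa> by (simp add: k_def)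
      have "(\<Prod>i<Suc n. k (I i) * mid_slope (I i)) * len (I 0)
          = k (I n) * mid_slope (I n) * ((\<Prod>i<n. k (I i) * mid_slope (I i)) * len (I 0))"
        by simp
      also have "\<dots> \<le> k (I n) * mid_slope (I n) * len (I n)"
        by (rule mult_left_mono[OF Suc less_imp_le[OF pos]])
      also have "\<dots> \<le> len (I (Suc n))"
        using len[OF I_in I_in] I(3) by blast
      finally show ?case .
    qed simp
    have "I (card C) = I 0" using I(4)[rule_format, of "card C" 0] by simp
    then have "(\<Prod>i<card C. k (I i) * mid_slope (I i)) \<le> 1"
      using iter[of "card C"] len_pos[of 0] by simp
    also have "(\<Prod>i<card C. k (I i) * mid_slope (I i)) = (\<Prod>X\<in>C. k X * mid_slope X)"
      by (rule prod.reindex_bij_betw[OF I(6)])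
    also have "\<dots> = (\<Prod>X\<in>C. k X) * expansion C" by (simp add: prod.distrib expansion_def)
    also have "(\<Prod>X\<in>C. k X) = \<kappa> ^ card {X \<in> C. X \<inter> P \<noteq> {}}"
    proof -
      have "(\<Prod>X\<in>C. k X) = (\<Prod>X\<in>C. if X \<inter> P \<noteq> {} then \<kappa> else 1)"
        by (rule prod.cong) (simp_all add: k_def)
      also have "\<dots> = (\<Prod>X\<in>{X \<in> C. X \<inter> P \<noteq> {}}. \<kappa>)"
        by (rule prod.inter_filter[OF cycle_finite[OF C], symmetric])
      finally show ?thesis by simp
    qed
    finally have le1: "\<kappa> ^ card {X \<in> C. X \<inter> P \<noteq> {}} * expansion C \<le> 1" .
    have "\<kappa> ^ card P \<le> \<kappa> ^ card {X \<in> C. X \<inter> P \<noteq> {}}"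
      using \<kappa> card_breaking[OF C] by (intro power_decreasing) auto
    then have "\<kappa> ^ card P * expansion C \<le> \<kappa> ^ card {X \<in> C. X \<inter> P \<noteq> {}} * expansion C"
      using expansion_pos[OF C] by (intro mult_right_mono) auto
    then have "\<kappa> ^ card P * expansion C \<le> 1" using le1 by linarith
    then show ?thesis using \<kappa> by (simp add: field_simps)
  qed
  then show ?thesis by blast
qed

text \<open>
  All values that the product of the slopes over one point in each interval with breakpoints
  can have. Finiteness of this set is what excludes slow convergence.
\<close>

definition breaking_products :: "real set" where
  "breaking_products = prod_list ` {xs. set xs \<subseteq> sl ` ({0..1} - P) \<and> length xs \<le> card P}"

lemma finite_breaking_products: "finite breaking_products"
  unfolding breaking_products_def by (intro finite_imageI finite_lists_length_le finite_slopes)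

lemma breaking_productI:
  assumes C: "is_cycle f C" and g: "\<And>X. X \<in> C \<Longrightarrow> g X \<in> {0..1} - P"
  shows "(\<Prod>X\<in>C. if X \<inter> P = {} then 1 else sl (g X)) \<in> breaking_products"
proof -
  let ?Br = "{X \<in> C. X \<inter> P \<noteq> {}}"
  have fin: "finite ?Br" using cycle_finite[OF C] by simp
  obtain xs where xs: "set xs = ?Br" "distinct xs" using finite_distinct_list[OF fin] by (elim exE conjE)
  have "(\<Prod>X\<in>C. if X \<inter> P = {} then 1 else sl (g X)) = (\<Prod>X\<in>C. if X \<inter> P \<noteq> {} then sl (g X) else 1)"
    by (rule prod.cong) simp_all
  also have "\<dots> = (\<Prod>X\<in>?Br. sl (g X))"
    by (rule prod.inter_filter[OF cycle_finite[OF C], symmetric])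
  also have "\<dots> = prod_list (map (\<lambda>X. sl (g X)) xs)"
    unfolding xs(1)[symmetric] by (rule prod.distinct_set_conv_list[OF xs(2)])
  also have "\<dots> \<in> breaking_products"
    unfolding breaking_products_def
  proof (intro imageI CollectI conjI)
    show "set (map (\<lambda>X. sl (g X)) xs) \<subseteq> sl ` ({0..1} - P)"
      using g unfolding set_map xs(1) by blast
    show "length (map (\<lambda>X. sl (g X)) xs) \<le> card P"
      using card_breaking[OF C] distinct_card[OF xs(2)] unfolding xs(1) by simp
  qed
  finally show ?thesis .
qed

end

section \<open>Slopes across one refinement\<close>

text \<open>
  Used with the slopes \<open>p\<close> of the intervals and \<open>g\<close> of the gaps between them: on either side
  of the interval \<open>k\<close>, each interval is paired with the gap adjacent to it in the direction
  of \<open>k\<close>.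
\<close>

lemma prod_skip_one:
  fixes p g :: "nat \<Rightarrow> real"
  assumes "k \<le> m" "p k = 1" "\<And>j. j < k \<Longrightarrow> p j = g j" "\<And>j. k \<le> j \<Longrightarrow> j < m \<Longrightarrow> p (Suc j) = g j"
  shows "(\<Prod>j\<le>m. p j) = (\<Prod>j<m. g j)"
  using assms
proof (induction m)
  case (Suc m)
  show ?case
  proof (cases "k \<le> m")
    case True
    then have "(\<Prod>j\<le>m. p j) = (\<Prod>j<m. g j)" using Suc by auto
    moreover have "p (Suc m) = g m" using Suc.prems(4)[of m] True by simp
    ultimately show ?thesis by simp
  next
    case False
    then have "k = Suc m" using Suc.prems(1) by simp
    then show ?thesis using Suc.prems(2,3) by (simp flip: lessThan_Suc_atMost)
  qed
qed simp

text \<open>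
  A cycle \<open>C\<close> and a refinement \<open>D\<close>, both enumerated along the dynamics by \<open>I\<close> and \<open>J\<close>, such
  that breakpoints are neither lost (\<open>P_sub\<close>) nor separated (\<open>unique\<close>) by the refinement. The
  \<open>Suc m\<close> intervals of \<open>D\<close> inside \<open>X\<close> are \<open>{L X j..R X j}\<close> for \<open>j \<le> m\<close>, from left to right,
  so there are \<open>m\<close> gaps between them.
\<close>

locale ordered_refinement = affine_pieces f sl P for f sl P +
  fixes C D :: "real set set" and m :: nat and I J :: "nat \<Rightarrow> real set"
    and L R :: "real set \<Rightarrow> nat \<Rightarrow> real"
  assumes C: "is_cycle f C" and D: "is_cycle f D" and sub: "\<Union>D \<subseteq> \<Union>C"
    and m: "m \<ge> 2" and card_pieces: "X \<in> C \<Longrightarrow> card {Y \<in> D. Y \<subseteq> X} = Suc m"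
    and nondeg: "Y \<in> D \<Longrightarrow> Inf Y < Sup Y"
    and P_sub: "P \<inter> \<Union>C \<subseteq> \<Union>D"
    and unique: "X \<in> C \<Longrightarrow> Y \<in> D \<Longrightarrow> Z \<in> D \<Longrightarrow> Y \<subseteq> X \<Longrightarrow> Z \<subseteq> X \<Longrightarrow>
                 Y \<inter> P \<noteq> {} \<Longrightarrow> Z \<inter> P \<noteq> {} \<Longrightarrow> Y = Z"
    and I_range: "range I = C" and I_map: "f ` I i \<subseteq> I (Suc i)"
    and I_eq: "I i = I j \<longleftrightarrow> i mod card C = j mod card C" and I_bij: "bij_betw I {..<card C} C"
    and J_range: "range J = D" and J_map: "f ` J i \<subseteq> J (Suc i)"
    and J_eq: "J i = J j \<longleftrightarrow> i mod card D = j mod card D" and J_sub: "J i \<subseteq> I i"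
    and pieces: "X \<in> C \<Longrightarrow> {Y \<in> D. Y \<subseteq> X} = (\<lambda>j. {L X j..R X j}) ` {..m}"
    and LR: "X \<in> C \<Longrightarrow> j \<le> m \<Longrightarrow> L X j \<le> R X j"
    and RL: "X \<in> C \<Longrightarrow> j < m \<Longrightarrow> R X j < L X (Suc j)"
begin

lemma I_in [simp]: "I i \<in> C" using I_range by blast

lemma J_in: "J i \<in> D" using J_range by blast

lemma C_pos: "0 < card C"
  using cycle_nonempty[OF C] cycle_finite[OF C] by (simp add: card_gt_0_iff)

lemma piece: "X \<in> C \<Longrightarrow> j \<le> m \<Longrightarrow> {L X j..R X j} \<in> D" "X \<in> C \<Longrightarrow> j \<le> m \<Longrightarrow> {L X j..R X j} \<subseteq> X"
proof -
  assume X: "X \<in> C" and j: "j \<le> m"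
  have "{L X j..R X j} \<in> (\<lambda>j. {L X j..R X j}) ` {..m}" using j by (intro imageI) simp
  then have "{L X j..R X j} \<in> {Y \<in> D. Y \<subseteq> X}" unfolding pieces[OF X] .
  then show "{L X j..R X j} \<in> D" "{L X j..R X j} \<subseteq> X" by (simp_all del: atLeastatMost_subset_iff)
qed

lemma pieceE:
  assumes "X \<in> C" "Y \<in> D" "Y \<subseteq> X"
  obtains j where "j \<le> m" "Y = {L X j..R X j}"
proof -
  have "Y \<in> (\<lambda>j. {L X j..R X j}) ` {..m}" unfolding pieces[OF assms(1), symmetric] using assms by simp
  then obtain j where "Y = {L X j..R X j}" "j \<in> {..m}" by (rule imageE)
  then show thesis using that[of j] by simp
qed

lemma LR_strict: "X \<in> C \<Longrightarrow> j \<le> m \<Longrightarrow> L X j < R X j"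
  using nondeg[OF piece(1), of X j] LR[of X j] by simp

lemma ends_in: "X \<in> C \<Longrightarrow> j \<le> m \<Longrightarrow> L X j \<in> X" "X \<in> C \<Longrightarrow> j \<le> m \<Longrightarrow> R X j \<in> X"
  using piece(2)[of X j] LR[of X j] by auto

lemma RL_less: "X \<in> C \<Longrightarrow> i < j \<Longrightarrow> j \<le> m \<Longrightarrow> R X i < L X j"
proof (induction j)
  case (Suc j)
  show ?case
  proof (cases "i = j")
    case True
    then show ?thesis using Suc.prems RL[of X j] by simp
  next
    case False
    then have "R X i < L X j" using Suc by simp
    also have "L X j \<le> R X j" using Suc.prems by (intro LR) auto
    also have "R X j < L X (Suc j)" using Suc.prems by (intro RL) auto
    finally show ?thesis .
  qed
qed simp

lemma L_mono: "X \<in> C \<Longrightarrow> i \<le> j \<Longrightarrow> j \<le> m \<Longrightarrow> L X i \<le> L X j"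
  using RL_less[of X i j] LR[of X i] by (cases "i = j") auto

lemma R_mono: "X \<in> C \<Longrightarrow> i \<le> j \<Longrightarrow> j \<le> m \<Longrightarrow> R X i \<le> R X j"
  using RL_less[of X i j] LR[of X j] by (cases "i = j") auto

lemma L_less_iff: "X \<in> C \<Longrightarrow> i \<le> m \<Longrightarrow> j \<le> m \<Longrightarrow> L X i < L X j \<longleftrightarrow> i < j"
  using RL_less[of X i j] LR[of X i] L_mono[of X j i] by (cases "i < j") auto

lemma pieces_inj: "X \<in> C \<Longrightarrow> i \<le> m \<Longrightarrow> j \<le> m \<Longrightarrow> {L X i..R X i} = {L X j..R X j} \<Longrightarrow> i = j"
proof -
  assume *: "X \<in> C" "i \<le> m" "j \<le> m" "{L X i..R X i} = {L X j..R X j}"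
  then have "L X i = L X j" using LR[of X i] LR[of X j] by simp
  then show "i = j" using L_less_iff[of X i j] L_less_iff[of X j i] * by linarith
qed

lemma segment_in:
  assumes "X \<in> C" "a \<in> X" "b \<in> X"
  shows "{a..b} \<subseteq> X" "0 \<le> a" "b \<le> 1"
proof -
  obtain c d where "0 \<le> c" "c \<le> d" "d \<le> 1" "X = {c..d}"
    by (rule cycle_interval[OF C assms(1)], rule that)
  then show "{a..b} \<subseteq> X" "0 \<le> a" "b \<le> 1" using assms by auto
qed

lemma gap_avoids_D:
  assumes X: "X \<in> C" and j: "j < m" and x: "R X j < x" "x < L X (Suc j)" and Y: "Y \<in> D"
  shows "x \<notin> Y"
proof
  assume "x \<in> Y"
  have "x \<in> X" using segment_in(1)[OF X ends_in(2)[OF X, of j] ends_in(1)[OF X, of "Suc j"]] j x by auto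
  obtain X' where X': "X' \<in> C" "Y \<subseteq> X'" by (rule subcycle_member[OF C D sub Y])
  have "X' = X" using X'(2) \<open>x \<in> Y\<close> \<open>x \<in> X\<close> by (intro cycle_disjoint[OF C X'(1) X, of x]) auto
  then obtain i where i: "i \<le> m" "Y = {L X i..R X i}" using pieceE[OF X Y] X'(2) by auto
  show False
  proof (cases "i \<le> j")
    case True
    then show False using R_mono[OF X True] \<open>x \<in> Y\<close> i x j by auto
  next
    case False
    then show False using L_mono[OF X, of "Suc j" i] \<open>x \<in> Y\<close> i x by auto
  qed
qed

lemma gap_free:
  assumes X: "X \<in> C" and j: "j < m"
  shows "{R X j<..<L X (Suc j)} \<inter> P = {}"
proof (rule ccontr)
  assume "{R X j<..<L X (Suc j)} \<inter> P \<noteq> {}"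
  then obtain x where x: "R X j < x" "x < L X (Suc j)" "x \<in> P" by auto
  have "x \<in> X" using segment_in(1)[OF X ends_in(2)[OF X, of j] ends_in(1)[OF X, of "Suc j"]] j x by auto
  then have "x \<in> \<Union>D" using P_sub X x(3) by blast
  then show False using gap_avoids_D[OF X j x(1,2)] by auto
qed

lemma gap_bounds: "X \<in> C \<Longrightarrow> j < m \<Longrightarrow> 0 \<le> R X j" "X \<in> C \<Longrightarrow> j < m \<Longrightarrow> L X (Suc j) \<le> 1"
  using segment_in(2,3)[of X "R X j" "L X (Suc j)"] ends_in(2)[of X j] ends_in(1)[of X "Suc j"] by auto

definition gap_slope :: "real set \<Rightarrow> nat \<Rightarrow> real" where
  "gap_slope X j = sl ((R X j + L X (Suc j)) / 2)"

lemma gap_slope_eq: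
  assumes X: "X \<in> C" and j: "j < m" and x: "R X j < x" "x < L X (Suc j)"
  shows "sl x = gap_slope X j"
  unfolding gap_slope_def using gap_bounds[OF X j] gap_free[OF X j] x RL[OF X j]
  by (intro slope_cong[of "R X j" "L X (Suc j)"]) auto

lemma gap_image_length:
  assumes X: "X \<in> C" and j: "j < m"
  shows "\<bar>f (R X j) - f (L X (Suc j))\<bar> = gap_slope X j * (L X (Suc j) - R X j)"
proof -
  have "(R X j + L X (Suc j)) / 2 \<in> {R X j<..<L X (Suc j)}" using RL[OF X j] by auto
  then show ?thesis
    using slope[OF gap_bounds[OF X j] gap_free[OF X j], of _ "R X j" "L X (Suc j)"] RL[OF X j]
    by (simp add: gap_slope_def)
qed

lemma gap_slope_pos:
  assumes X: "X \<in> C" and j: "j < m"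
  shows "0 < gap_slope X j"
proof -
  have x: "(R X j + L X (Suc j)) / 2 \<in> {R X j<..<L X (Suc j)}" using RL[OF X j] by auto
  then have "(R X j + L X (Suc j)) / 2 \<notin> P" using gap_free[OF X j] by blast
  then show ?thesis unfolding gap_slope_def using gap_bounds[OF X j] x by (intro slope_pos) auto
qed

lemma piece_slope_left:
  assumes X: "X \<in> C" and j: "j < m" and free: "{L X j..R X j} \<inter> P = {}"
  shows "mid_slope {L X j..R X j} = gap_slope X j"
proof -
  have lt: "L X j < R X j" using LR_strict[OF X, of j] j by simp
  have "{L X j<..<L X (Suc j)} \<inter> P = {}"
  proof (rule ccontr)
    assume "{L X j<..<L X (Suc j)} \<inter> P \<noteq> {}"
    then obtain x where x: "L X j < x" "x < L X (Suc j)" "x \<in> P" by auto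
    then have "x \<in> {L X j..R X j} \<or> x \<in> {R X j<..<L X (Suc j)}" by auto
    then show False using x(3) free gap_free[OF X j] by blast
  qed
  moreover have "0 \<le> L X j" "L X (Suc j) \<le> 1"
    using segment_in(2,3)[OF X ends_in(1)[OF X, of j] ends_in(1)[OF X, of "Suc j"]] j by auto
  ultimately show ?thesis
    using free lt RL[OF X j] unfolding gap_slope_def mid_slope_def
    by (simp, intro slope_cong[of "L X j" "L X (Suc j)"]) auto
qed

lemma piece_slope_right:
  assumes X: "X \<in> C" and j: "j < m" and free: "{L X (Suc j)..R X (Suc j)} \<inter> P = {}"
  shows "mid_slope {L X (Suc j)..R X (Suc j)} = gap_slope X j"
proof -
  have lt: "L X (Suc j) < R X (Suc j)" using LR_strict[OF X, of "Suc j"] j by simp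
  have "{R X j<..<R X (Suc j)} \<inter> P = {}"
  proof (rule ccontr)
    assume "{R X j<..<R X (Suc j)} \<inter> P \<noteq> {}"
    then obtain x where x: "R X j < x" "x < R X (Suc j)" "x \<in> P" by auto
    then have "x \<in> {L X (Suc j)..R X (Suc j)} \<or> x \<in> {R X j<..<L X (Suc j)}" by auto
    then show False using x(3) free gap_free[OF X j] by blast
  qed
  moreover have "0 \<le> R X j" "R X (Suc j) \<le> 1"
    using segment_in(2,3)[OF X ends_in(2)[OF X, of j] ends_in(2)[OF X, of "Suc j"]] j by auto
  ultimately show ?thesis
    using free lt RL[OF X j] unfolding gap_slope_def mid_slope_def
    by (simp, intro slope_cong[of "R X j" "R X (Suc j)"]) auto
qed

lemma inner_slope:
  assumes X: "X \<in> C" "X \<inter> P = {}" and x: "R X 0 \<le> x \<or> L X 0 < x" "x < R X m"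
  shows "sl x = mid_slope X"
proof -
  obtain a b where ab: "0 \<le> a" "a \<le> b" "b \<le> 1" "X = {a..b}"
    by (rule cycle_interval[OF C X(1)], rule that)
  have "{a<..<b} \<subseteq> X" using ab by auto
  then have free: "{a<..<b} \<inter> P = {}" using X(2) by blast
  have "a \<le> L X 0" "R X m \<le> b" using ends_in[OF X(1), of 0] ends_in[OF X(1), of m] ab by auto
  then have xab: "x \<in> {a<..<b}" using x LR_strict[OF X(1), of 0] by auto
  then have "sl x = sl ((a + b) / 2)" using free ab by (intro slope_cong[of a b]) auto
  then show ?thesis using X(2) ab by (simp add: mid_slope_def)
qed

text \<open>
  If \<open>X\<close> contains breakpoints, they lie in a single interval of \<open>D\<close>, which contributes the
  factor one, and the others are paired with the gaps. If not, there is one slope on \<open>X\<close>,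
  which occurs once for \<open>X\<close> and \<open>m\<close> times for the gaps.
\<close>

lemma row_expansion:
  assumes X: "X \<in> C"
  shows "(\<Prod>j\<le>m. mid_slope {L X j..R X j}) = mid_slope X * (\<Prod>j<m. gap_slope X j)"
proof (cases "X \<inter> P = {}")
  case True
  have free: "{L X j..R X j} \<inter> P = {}" if "j \<le> m" for j using piece(2)[OF X that] True by blast
  have "L X 0 < R X 0" "R X 0 \<le> R X m" using LR_strict[OF X, of 0] R_mono[OF X, of 0 m] by auto
  then have "sl ((L X 0 + R X 0) / 2) = mid_slope X" using X True by (intro inner_slope) auto
  then have "mid_slope {L X 0..R X 0} = mid_slope X"
    using free[of 0] \<open>L X 0 < R X 0\<close> by (simp add: mid_slope_def[of "{L X 0..R X 0}"])
  moreover have "(\<Prod>j<m. mid_slope {L X (Suc j)..R X (Suc j)}) = (\<Prod>j<m. gap_slope X j)"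
    using piece_slope_right[OF X] free by (intro prod.cong) auto
  ultimately show ?thesis by (simp add: prod.atMost_shift)
next
  case False
  then obtain x where x: "x \<in> X" "x \<in> P" by blast
  then have "x \<in> \<Union>D" using P_sub X by blast
  then obtain Y where Y: "Y \<in> D" "x \<in> Y" by blast
  obtain X' where X': "X' \<in> C" "Y \<subseteq> X'" by (rule subcycle_member[OF C D sub Y(1)])
  have "X' = X" using X'(2) Y(2) x(1) by (intro cycle_disjoint[OF C X'(1) X, of x]) auto
  then obtain k where k: "k \<le> m" "Y = {L X k..R X k}" using pieceE[OF X Y(1)] X'(2) by auto
  have Yx: "Y \<inter> P \<noteq> {}" using Y(2) x(2) by blast
  have free: "{L X j..R X j} \<inter> P = {}" if "j \<le> m" "j \<noteq> k" for j
  proof (rule ccontr)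
    assume "{L X j..R X j} \<inter> P \<noteq> {}"
    then have "{L X j..R X j} = Y"
      using X'(2) Yx \<open>X' = X\<close> by (intro unique[OF X piece(1)[OF X that(1)] Y(1) piece(2)[OF X that(1)]]) auto
    then show False using pieces_inj[OF X that(1) k(1)] k(2) that(2) by simp
  qed
  have "(\<Prod>j\<le>m. mid_slope {L X j..R X j}) = (\<Prod>j<m. gap_slope X j)"
  proof (rule prod_skip_one[OF k(1)])
    show "mid_slope {L X k..R X k} = 1" using Yx k(2) by (simp add: mid_slope_def)
    show "mid_slope {L X j..R X j} = gap_slope X j" if "j < k" for j
      using that k(1) by (intro piece_slope_left[OF X] free) auto
    show "mid_slope {L X (Suc j)..R X (Suc j)} = gap_slope X j" if "k \<le> j" "j < m" for j
      using that by (intro piece_slope_right[OF X] free) auto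
  qed
  then show ?thesis using False by (simp add: mid_slope_def)
qed

lemma D_eq: "D = (\<Union>X\<in>C. {Y \<in> D. Y \<subseteq> X})"
proof
  show "D \<subseteq> (\<Union>X\<in>C. {Y \<in> D. Y \<subseteq> X})"
  proof
    fix Y assume Y: "Y \<in> D"
    obtain X where "X \<in> C" "Y \<subseteq> X" by (rule subcycle_member[OF C D sub Y])
    then show "Y \<in> (\<Union>X\<in>C. {Y \<in> D. Y \<subseteq> X})" using Y by blast
  qed
qed auto

lemma card_D: "card D = Suc m * card C"
proof -
  have "D = {Y \<in> D. \<exists>X\<in>C. Y \<subseteq> X}" using D_eq by blast
  then show ?thesis using card_subcycle[OF C D sub order_refl card_pieces] by simp
qed

lemma expansion_D: "expansion D = expansion C * (\<Prod>i<card C. \<Prod>j<m. gap_slope (I i) j)"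
proof -
  have "expansion D = (\<Prod>X\<in>C. \<Prod>Y\<in>{Y \<in> D. Y \<subseteq> X}. mid_slope Y)"
    unfolding expansion_def
  proof (subst D_eq, rule prod.UNION_disjoint)
    show "finite C" by (rule cycle_finite[OF C])
    show "\<forall>X\<in>C. finite {Y \<in> D. Y \<subseteq> X}" using cycle_finite[OF D] by simp
    show "\<forall>X\<in>C. \<forall>Z\<in>C. X \<noteq> Z \<longrightarrow> {Y \<in> D. Y \<subseteq> X} \<inter> {Y \<in> D. Y \<subseteq> Z} = {}"
    proof (intro ballI impI, rule ccontr)
      fix X Z assume XZ: "X \<in> C" "Z \<in> C" "X \<noteq> Z" "{Y \<in> D. Y \<subseteq> X} \<inter> {Y \<in> D. Y \<subseteq> Z} \<noteq> {}"
      then obtain Y where Y: "Y \<in> D" "Y \<subseteq> X" "Y \<subseteq> Z" by blast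
      then obtain y where "y \<in> Y" using cycle_nonempty_member[OF D Y(1)] by blast
      then show False using cycle_disjoint[OF C XZ(1,2), of y] Y XZ(3) by blast
    qed
  qed
  also have "\<dots> = (\<Prod>X\<in>C. mid_slope X * (\<Prod>j<m. gap_slope X j))"
  proof (rule prod.cong[OF refl])
    fix X assume X: "X \<in> C"
    have "inj_on (\<lambda>j. {L X j..R X j}) {..m}" using pieces_inj[OF X] by (auto intro!: inj_onI)
    then show "(\<Prod>Y\<in>{Y \<in> D. Y \<subseteq> X}. mid_slope Y) = mid_slope X * (\<Prod>j<m. gap_slope X j)"
      unfolding pieces[OF X] row_expansion[OF X, symmetric] by (simp add: prod.reindex)
  qed
  also have "\<dots> = expansion C * (\<Prod>X\<in>C. \<Prod>j<m. gap_slope X j)"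
    by (simp add: prod.distrib expansion_def)
  also have "(\<Prod>X\<in>C. \<Prod>j<m. gap_slope X j) = (\<Prod>i<card C. \<Prod>j<m. gap_slope (I i) j)"
    by (rule prod.reindex_bij_betw[OF I_bij, symmetric])
  finally show ?thesis .
qed

text \<open>
  Distinct intervals of a cycle are disjoint, so a point can come back to its interval only
  after a multiple of the period.
\<close>

lemma return_time:
  assumes Y: "Y \<in> D" and x: "x \<in> Y" "(f ^^ k) x \<in> Y"
  shows "card D dvd k"
proof -
  obtain n where n: "Y = J n" using Y J_range by blast
  have "(f ^^ k) x \<in> J (n + k)" for k
  proof (induction k)
    case (Suc k)
    then show ?case using J_map[of "n + k"] by auto
  qed (use x n in simp)
  then have "J (n + k) = J n" using x(2) n by (intro cycle_disjoint[OF D J_in J_in]) auto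
  then have "(k + n) mod card D = (0 + n) mod card D" using J_eq by (simp add: add.commute)
  then show ?thesis unfolding mod_eq_shift by (simp add: mod_eq_0_iff_dvd)
qed

lemma permutation_of_pieces:
  "\<exists>\<theta>. bij_betw \<theta> {..m} {..m} \<and> (\<forall>j\<le>m. f ` {L (I i) j..R (I i) j} \<subseteq> {L (I (Suc i)) (\<theta> j)..R (I (Suc i)) (\<theta> j)})"
proof -
  have next_J: "\<exists>k. {L (I i) j..R (I i) j} = J k \<and> J (Suc k) \<subseteq> I (Suc i)" if j: "j \<le> m" for j
  proof -
    obtain k where k: "{L (I i) j..R (I i) j} = J k" using piece(1)[OF I_in j] J_range by blast
    have L: "L (I i) j \<in> J k" using LR[OF I_in j] unfolding k[symmetric] by simp
    then have "I k = I i"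
      using J_sub[of k] ends_in(1)[OF I_in j] by (intro cycle_disjoint[OF C I_in I_in, of "L (I i) j"]) auto
    then have "I (Suc k) = I (Suc i)" unfolding I_eq using mod_eq_shift[of k 1] by simp
    then show ?thesis using k J_sub[of "Suc k"] by auto
  qed
  have "\<forall>j. \<exists>t. j \<le> m \<longrightarrow> t \<le> m \<and> f ` {L (I i) j..R (I i) j} \<subseteq> {L (I (Suc i)) t..R (I (Suc i)) t}"
  proof
    fix j
    show "\<exists>t. j \<le> m \<longrightarrow> t \<le> m \<and> f ` {L (I i) j..R (I i) j} \<subseteq> {L (I (Suc i)) t..R (I (Suc i)) t}"
    proof (cases "j \<le> m")
      case True
      from next_J[OF True] obtain k where k: "{L (I i) j..R (I i) j} = J k" "J (Suc k) \<subseteq> I (Suc i)"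
        by blast
      obtain t where "t \<le> m" "J (Suc k) = {L (I (Suc i)) t..R (I (Suc i)) t}"
        by (rule pieceE[OF I_in J_in k(2)])
      then show ?thesis using J_map[of k] k(1) by (intro exI[of _ t]) simp
    qed simp
  qed
  then obtain \<theta> where \<theta>: "\<And>j. j \<le> m \<Longrightarrow> \<theta> j \<le> m"
    "\<And>j. j \<le> m \<Longrightarrow> f ` {L (I i) j..R (I i) j} \<subseteq> {L (I (Suc i)) (\<theta> j)..R (I (Suc i)) (\<theta> j)}"
    by metis
  have target: "{L (I (Suc i)) (\<theta> j)..R (I (Suc i)) (\<theta> j)} = J (Suc k)"
    if "j \<le> m" "{L (I i) j..R (I i) j} = J k" for j k
  proof -
    have L: "L (I i) j \<in> {L (I i) j..R (I i) j}" using LR[OF I_in that(1)] by simp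
    then have "f (L (I i) j) \<in> J (Suc k)" using J_map[of k] that(2) by blast
    moreover have "f (L (I i) j) \<in> {L (I (Suc i)) (\<theta> j)..R (I (Suc i)) (\<theta> j)}"
      using L \<theta>(2)[OF that(1)] by blast
    ultimately show ?thesis
      using piece(1)[OF I_in \<theta>(1)[OF that(1)]] by (intro cycle_disjoint[OF D _ J_in])
  qed
  have "inj_on \<theta> {..m}"
  proof (rule inj_onI)
    fix j j' assume "j \<in> {..m}" "j' \<in> {..m}" and eq: "\<theta> j = \<theta> j'"
    then have j: "j \<le> m" "j' \<le> m" by auto
    obtain k k' where k: "{L (I i) j..R (I i) j} = J k" "{L (I i) j'..R (I i) j'} = J k'"
      using next_J[OF j(1)] next_J[OF j(2)] by blast
    have "J (Suc k) = J (Suc k')" using target[OF j(1) k(1)] target[OF j(2) k(2)] eq by simp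
    then have "J k = J k'" unfolding J_eq using mod_eq_shift[of k 1 "card D" k'] by simp
    then show "j = j'" using k by (intro pieces_inj[OF I_in[of i] j]) simp
  qed
  moreover have "\<theta> ` {..m} \<subseteq> {..m}" using \<theta>(1) by auto
  ultimately have "bij_betw \<theta> {..m} {..m}" by (simp add: bij_betw_def endo_inj_surj)
  then show ?thesis using \<theta>(2) by blast
qed

lemma hull_gap:
  assumes X: "X \<in> C" and x: "L X 0 \<le> x" "x \<le> R X m" "x \<notin> \<Union>D"
  shows "\<exists>j<m. R X j < x \<and> x < L X (Suc j)"
proof -
  have out: "x < L X j \<or> R X j < x" if "j \<le> m" for j using x(3) piece(1)[OF X that] by force
  have "\<not> x \<le> R X 0" using out[of 0] x(1) by auto
  with x(2) obtain k where k: "k < m" "\<forall>i\<le>k. \<not> x \<le> R X i" "x \<le> R X (Suc k)"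
    using ex_least_nat_less[of "\<lambda>k. x \<le> R X k" m] by blast
  then show ?thesis using out[of "Suc k"] by (intro exI[of _ k]) auto
qed

lemma length_of_gaps:
  assumes X: "X \<in> C"
  shows "a < b \<Longrightarrow> b \<le> m \<Longrightarrow> (\<Sum>k\<in>{a..<b}. L X (Suc k) - R X k) \<le> L X b - R X a"
proof (induction b)
  case (Suc b)
  show ?case
  proof (cases "a = b")
    case False
    then have "(\<Sum>k\<in>{a..<b}. L X (Suc k) - R X k) \<le> L X b - R X a" using Suc by simp
    moreover have "L X b \<le> R X b" using Suc.prems by (intro LR[OF X]) simp
    ultimately show ?thesis using Suc.prems(1) by simp
  qed simp
qed simp

text \<open>
  The return map of \<open>I 0\<close> sends the two ends of the hull of the intervals of \<open>D\<close> in \<open>I 0\<close>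
  back into this hull, so it has a fixed point there by the intermediate value theorem. The
  orbit of this point avoids the intervals of \<open>D\<close>, whose period is longer. It also stays in
  the hulls, because \<open>f\<close> is monotone on each gap and sends its end points to intervals of
  \<open>D\<close>.
\<close>

lemma orbit_through_gaps:
  "\<exists>p. (f ^^ card C) p = p \<and> (\<forall>i. \<exists>j<m. R (I i) j < (f ^^ i) p \<and> (f ^^ i) p < L (I i) (Suc j))"
proof -
  let ?g = "f ^^ card C" and ?a = "L (I 0) 0" and ?b = "R (I 0) m"
  have follow: "\<exists>j'\<le>m. (f ^^ n) x \<in> {L (I n) j'..R (I n) j'}"
    if "j \<le> m" "x \<in> {L (I 0) j..R (I 0) j}" for n j x
  proof (induction n)
    case (Suc n)
    then obtain j' where j': "j' \<le> m" "(f ^^ n) x \<in> {L (I n) j'..R (I n) j'}" by blast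
    obtain \<theta> where \<theta>: "bij_betw \<theta> {..m} {..m}"
      "\<forall>j\<le>m. f ` {L (I n) j..R (I n) j} \<subseteq> {L (I (Suc n)) (\<theta> j)..R (I (Suc n)) (\<theta> j)}"
      using permutation_of_pieces[of n] by blast
    have "\<theta> j' \<le> m" using bij_betwE[OF \<theta>(1)] j'(1) by auto
    moreover have "(f ^^ Suc n) x \<in> {L (I (Suc n)) (\<theta> j')..R (I (Suc n)) (\<theta> j')}"
      using \<theta>(2) j' by (simp add: image_subset_iff)
    ultimately show ?case by blast
  qed (use that in auto)
  have period: "I (card C) = I 0" unfolding I_eq by simp
  have hull: "?a \<le> ?g x \<and> ?g x \<le> ?b" if j: "j \<le> m" "x \<in> {L (I 0) j..R (I 0) j}" for j x
  proof -
    obtain j' where "j' \<le> m" "?g x \<in> {L (I 0) j'..R (I 0) j'}"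
      using follow[OF j, of "card C"] unfolding period by blast
    then show ?thesis using L_mono[OF I_in, of 0 j' 0] R_mono[OF I_in, of j' m 0] by auto
  qed
  have ab: "?a \<le> ?b" using LR[OF I_in, of 0 0] R_mono[OF I_in, of 0 m 0] by simp
  have "{?a..?b} \<subseteq> {0..1}"
    using segment_in(2,3)[OF I_in ends_in(1)[OF I_in, of 0 0] ends_in(2)[OF I_in, of m 0]] by auto
  then have cont: "continuous_on {?a..?b} (\<lambda>x. ?g x - x)"
    using continuous_on_subset[OF iterate_unit(1)] by (intro continuous_intros) auto
  have "?g ?b - ?b \<le> 0" using hull[of m ?b] LR[OF I_in, of m 0] by simp
  moreover have "0 \<le> ?g ?a - ?a" using hull[of 0 ?a] LR[OF I_in, of 0 0] by simp
  ultimately obtain p where p: "?a \<le> p" "p \<le> ?b" "?g p - p = 0"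
    using IVT2'[of "\<lambda>x. ?g x - x" ?b 0 ?a] ab cont by blast
  have fixed: "?g p = p" using p(3) by simp
  have avoid: "(f ^^ i) p \<notin> \<Union>D" for i
  proof
    assume "(f ^^ i) p \<in> \<Union>D"
    then obtain Y where Y: "Y \<in> D" "(f ^^ i) p \<in> Y" by blast
    have "?g ((f ^^ i) p) = (f ^^ i) (?g p)"
      by (metis add.commute comp_apply funpow_add)
    then have "card D dvd card C" using Y fixed by (intro return_time[OF Y]) simp
    then show False using card_D C_pos m by (auto dest!: dvd_imp_le)
  qed
  have "L (I i) 0 \<le> (f ^^ i) p \<and> (f ^^ i) p \<le> R (I i) m" for i
  proof (induction i)
    case (Suc i)
    then obtain j where j: "j < m" "R (I i) j < (f ^^ i) p" "(f ^^ i) p < L (I i) (Suc j)"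
      using hull_gap[OF I_in _ _ avoid] by blast
    obtain \<theta> where \<theta>: "bij_betw \<theta> {..m} {..m}"
      "\<forall>j\<le>m. f ` {L (I i) j..R (I i) j} \<subseteq> {L (I (Suc i)) (\<theta> j)..R (I (Suc i)) (\<theta> j)}"
      using permutation_of_pieces[of i] by blast
    have in_hull: "L (I (Suc i)) 0 \<le> f x \<and> f x \<le> R (I (Suc i)) m"
      if "k \<le> m" "x \<in> {L (I i) k..R (I i) k}" for k x
    proof -
      have "\<theta> k \<le> m" using bij_betwE[OF \<theta>(1)] that(1) by auto
      moreover have "f x \<in> {L (I (Suc i)) (\<theta> k)..R (I (Suc i)) (\<theta> k)}"
        using \<theta>(2) that by blast
      ultimately show ?thesis
        using L_mono[OF I_in, of 0 "\<theta> k" "Suc i"] R_mono[OF I_in, of "\<theta> k" m "Suc i"] by auto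
    qed
    have "R (I i) j \<in> {L (I i) j..R (I i) j}" "L (I i) (Suc j) \<in> {L (I i) (Suc j)..R (I i) (Suc j)}"
      using LR[OF I_in, of j i] LR[OF I_in, of "Suc j" i] j(1) by auto
    then show ?case
      using in_hull[of j "R (I i) j"] in_hull[of "Suc j" "L (I i) (Suc j)"] j(1)
        between_endpoints[OF gap_bounds[OF I_in j(1)] gap_free[OF I_in j(1)] j(2,3)]
      by (simp add: min_def max_def split: if_splits)
  qed (use p in simp)
  then show ?thesis using fixed hull_gap[OF I_in _ _ avoid] by blast
qed

text \<open>
  On an interval without breakpoints the slope at the orbit is the one that enters \<open>expansion
  C\<close>; the remaining factors form \<open>\<phi>\<close>.
\<close>

lemma orbit_slope_product:
  assumes p: "\<And>i. \<exists>j<m. R (I i) j < (f ^^ i) p \<and> (f ^^ i) p < L (I i) (Suc j)"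
  shows "\<exists>\<phi>\<in>breaking_products. (\<Prod>i<card C. sl ((f ^^ i) p)) = expansion C * \<phi>"
proof -
  define pt where "pt X = (f ^^ inv_into {..<card C} I X) p" for X
  have pt_I: "pt (I i) = (f ^^ i) p" if "i < card C" for i
    using that bij_betw_inv_into_left[OF I_bij, of i] by (simp add: pt_def)
  have pt: "\<exists>j<m. R X j < pt X \<and> pt X < L X (Suc j)" if X: "X \<in> C" for X
  proof -
    obtain i where i: "i < card C" "X = I i" using bij_betw_imp_surj_on[OF I_bij] X by blast
    show ?thesis using p[of i] pt_I[OF i(1)] i(2) by simp
  qed
  have "(\<Prod>i<card C. sl ((f ^^ i) p)) = (\<Prod>i<card C. sl (pt (I i)))"
    using pt_I by (intro prod.cong) auto
  also have "\<dots> = (\<Prod>X\<in>C. sl (pt X))" by (rule prod.reindex_bij_betw[OF I_bij])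
  also have "\<dots> = (\<Prod>X\<in>C. mid_slope X * (if X \<inter> P = {} then 1 else sl (pt X)))"
  proof (rule prod.cong[OF refl])
    fix X assume X: "X \<in> C"
    show "sl (pt X) = mid_slope X * (if X \<inter> P = {} then 1 else sl (pt X))"
    proof (cases "X \<inter> P = {}")
      case True
      obtain j where j: "j < m" "R X j < pt X" "pt X < L X (Suc j)" using pt[OF X] by blast
      have "R X 0 \<le> R X j" "L X (Suc j) \<le> R X (Suc j)" "R X (Suc j) \<le> R X m"
        using j(1) LR[OF X, of "Suc j"] by (auto intro!: R_mono[OF X])
      then have "sl (pt X) = mid_slope X" using j by (intro inner_slope[OF X True]) auto
      then show ?thesis using True by simp
    qed (simp add: mid_slope_def)
  qed
  also have "\<dots> = expansion C * (\<Prod>X\<in>C. if X \<inter> P = {} then 1 else sl (pt X))"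
    by (simp add: prod.distrib expansion_def)
  finally have eq: "(\<Prod>i<card C. sl ((f ^^ i) p)) = expansion C * (\<Prod>X\<in>C. if X \<inter> P = {} then 1 else sl (pt X))" .
  have "(\<Prod>X\<in>C. if X \<inter> P = {} then 1 else sl (pt X)) \<in> breaking_products"
  proof (rule breaking_productI[OF C])
    fix X assume X: "X \<in> C"
    obtain j where j: "j < m" "R X j < pt X" "pt X < L X (Suc j)" using pt[OF X] by blast
    then have "pt X \<in> {R X j<..<L X (Suc j)}" by simp
    then have "pt X \<notin> P" using gap_free[OF X j(1)] by blast
    then show "pt X \<in> {0..1} - P" using gap_bounds[OF X j(1)] j by auto
  qed
  with eq show ?thesis by blast
qed

text \<open>
  In the proof, the image of gap \<open>j\<close> of \<open>I i\<close> covers exactly the gaps from \<open>lo i j\<close> up to,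
  but not including, \<open>hi i j\<close> of \<open>I (Suc i)\<close>. The inequality \<open>1 < T\<close> is strict since \<open>T = 1\<close>
  leaves no room in the images of the gaps \<open>e i\<close>: the end points \<open>E i\<close> of one are mapped to
  the end points of the next, and a self-map of two points without fixed points is an
  involution.
\<close>

lemma expansion_step:
  "\<exists>T. \<exists>\<phi>\<in>breaking_products. expansion D = expansion C * T \<and> 1 < T \<and> 1 \<le> expansion C * \<phi> \<and>
     (expansion C * \<phi> * (T - 1) < T \<longrightarrow> expansion C * \<phi> \<le> T)"
proof -
  let ?q = "card C"
  have "\<forall>i. \<exists>\<theta>. bij_betw \<theta> {..m} {..m} \<and>
     (\<forall>j\<le>m. f ` {L (I i) j..R (I i) j} \<subseteq> {L (I (Suc i)) (\<theta> j)..R (I (Suc i)) (\<theta> j)})"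
    using permutation_of_pieces by blast
  from choice[OF this] obtain \<theta> where \<theta>_bij: "\<And>i. bij_betw (\<theta> i) {..m} {..m}"
    and \<theta>_img: "\<And>i j. j \<le> m \<Longrightarrow> f ` {L (I i) j..R (I i) j} \<subseteq> {L (I (Suc i)) (\<theta> i j)..R (I (Suc i)) (\<theta> i j)}"
    by blast
  have \<theta>_le: "\<theta> i j \<le> m" if "j \<le> m" for i j using bij_betwE[OF \<theta>_bij[of i]] that by auto
  have \<theta>_inj: "\<theta> i j \<noteq> \<theta> i (Suc j)" if "j < m" for i j
    using inj_onD[OF bij_betw_imp_inj_on[OF \<theta>_bij[of i]], of j "Suc j"] that by auto
  define lo where "lo i j = min (\<theta> i j) (\<theta> i (Suc j))" for i j
  define hi where "hi i j = max (\<theta> i j) (\<theta> i (Suc j))" for i j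
  have lo_hi: "lo i j < hi i j" "hi i j \<le> m" if "j < m" for i j
    using \<theta>_inj[OF that, of i] \<theta>_le[of j i] \<theta>_le[of "Suc j" i] that by (auto simp: lo_def hi_def)
  have "\<forall>i. \<exists>\<pi>. bij_betw \<pi> {..<m} {..<m} \<and> (\<forall>j<m. lo i j \<le> \<pi> j \<and> \<pi> j < hi i j)"
    using perm_gap_matching[OF \<theta>_bij] unfolding lo_def hi_def by blast
  from choice[OF this] obtain \<pi> where \<pi>_bij: "\<And>i. bij_betw (\<pi> i) {..<m} {..<m}"
    and \<pi>: "\<And>i j. j < m \<Longrightarrow> lo i j \<le> \<pi> i j \<and> \<pi> i j < hi i j" by blast
  define v where "v i j = L (I i) (Suc j) - R (I i) j" for i j
  define s where "s i j = gap_slope (I i) j" for i j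
  define A where "A i j = {lo i j..<hi i j}" for i j
  have period: "I ?q = I 0" unfolding I_eq by simp
  have ends: "f (R (I i) j) \<in> {L (I (Suc i)) (\<theta> i j)..R (I (Suc i)) (\<theta> i j)}"
    "f (L (I i) (Suc j)) \<in> {L (I (Suc i)) (\<theta> i (Suc j))..R (I (Suc i)) (\<theta> i (Suc j))}"
    if "j < m" for i j
    using \<theta>_img[of j i] \<theta>_img[of "Suc j" i] LR[OF I_in, of j i] LR[OF I_in, of "Suc j" i] that
    by (auto simp: image_subset_iff)
  have low: "min (f (R (I i) j)) (f (L (I i) (Suc j))) \<le> R (I (Suc i)) (lo i j)"
    and high: "L (I (Suc i)) (hi i j) \<le> max (f (R (I i) j)) (f (L (I i) (Suc j)))"
    and low': "L (I (Suc i)) (lo i j) \<le> min (f (R (I i) j)) (f (L (I i) (Suc j)))"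
    and high': "max (f (R (I i) j)) (f (L (I i) (Suc j))) \<le> R (I (Suc i)) (hi i j)"
    if j: "j < m" for i j
  proof -
    consider "\<theta> i j < \<theta> i (Suc j)" | "\<theta> i (Suc j) < \<theta> i j" using \<theta>_inj[OF j, of i] by linarith
    then have "min (f (R (I i) j)) (f (L (I i) (Suc j))) \<le> R (I (Suc i)) (lo i j) \<and>
      L (I (Suc i)) (hi i j) \<le> max (f (R (I i) j)) (f (L (I i) (Suc j))) \<and>
      L (I (Suc i)) (lo i j) \<le> min (f (R (I i) j)) (f (L (I i) (Suc j))) \<and>
      max (f (R (I i) j)) (f (L (I i) (Suc j))) \<le> R (I (Suc i)) (hi i j)"
    proof cases
      case 1
      have "R (I (Suc i)) (\<theta> i j) < L (I (Suc i)) (\<theta> i (Suc j))"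
        using 1 \<theta>_le[of "Suc j" i] j by (intro RL_less[OF I_in]) auto
      then show ?thesis using ends[OF j, of i] 1 by (auto simp: lo_def hi_def)
    next
      case 2
      have "R (I (Suc i)) (\<theta> i (Suc j)) < L (I (Suc i)) (\<theta> i j)"
        using 2 \<theta>_le[of j i] j by (intro RL_less[OF I_in]) auto
      then show ?thesis using ends[OF j, of i] 2 by (auto simp: lo_def hi_def)
    qed
    then show "min (f (R (I i) j)) (f (L (I i) (Suc j))) \<le> R (I (Suc i)) (lo i j)"
      "L (I (Suc i)) (hi i j) \<le> max (f (R (I i) j)) (f (L (I i) (Suc j)))"
      "L (I (Suc i)) (lo i j) \<le> min (f (R (I i) j)) (f (L (I i) (Suc j)))"
      "max (f (R (I i) j)) (f (L (I i) (Suc j))) \<le> R (I (Suc i)) (hi i j)" by simp_all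
  qed
  have sv: "s i j * v i j = max (f (R (I i) j)) (f (L (I i) (Suc j))) - min (f (R (I i) j)) (f (L (I i) (Suc j)))"
    if "j < m" for i j
    using gap_image_length[OF I_in that, of i] unfolding s_def v_def by linarith

  obtain p where fixed: "(f ^^ ?q) p = p"
    and p_gap: "\<And>i. \<exists>j<m. R (I i) j < (f ^^ i) p \<and> (f ^^ i) p < L (I i) (Suc j)"
    using orbit_through_gaps by blast
  define e where "e i = (SOME j. j < m \<and> R (I i) j < (f ^^ i) p \<and> (f ^^ i) p < L (I i) (Suc j))" for i
  have e: "e i < m \<and> R (I i) (e i) < (f ^^ i) p \<and> (f ^^ i) p < L (I i) (Suc (e i))" for i
    unfolding e_def using someI_ex[OF p_gap[of i]] .
  have e_period: "e ?q = e 0" unfolding e_def period fixed by simp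
  have e_next: "lo i (e i) \<le> e (Suc i) \<and> e (Suc i) < hi i (e i)" for i
  proof -
    let ?x = "(f ^^ Suc i) p" and ?X = "I (Suc i)"
    have j: "e i < m" and l: "R (I i) (e i) < (f ^^ i) p" and r: "(f ^^ i) p < L (I i) (Suc (e i))"
      using e by simp_all
    have x: "min (f (R (I i) (e i))) (f (L (I i) (Suc (e i)))) \<le> ?x"
      "?x \<le> max (f (R (I i) (e i))) (f (L (I i) (Suc (e i))))"
      using between_endpoints[OF gap_bounds[OF I_in j] gap_free[OF I_in j] l r] by simp_all
    have "L ?X (lo i (e i)) < L ?X (Suc (e (Suc i)))"
      using low'[OF j, of i] x(1) e[of "Suc i"] by linarith
    moreover have "Suc (e (Suc i)) \<le> m" using e[of "Suc i"] by simp
    ultimately have 1: "lo i (e i) < Suc (e (Suc i))"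
      using lo_hi[OF j, of i] L_less_iff[OF I_in, of "lo i (e i)" "Suc (e (Suc i))" "Suc i"] by simp
    have "e (Suc i) < hi i (e i)"
    proof (rule ccontr)
      assume "\<not> e (Suc i) < hi i (e i)"
      then have "R ?X (hi i (e i)) \<le> R ?X (e (Suc i))"
        using e[of "Suc i"] by (intro R_mono[OF I_in]) auto
      then show False using high'[OF j, of i] x(2) e[of "Suc i"] by linarith
    qed
    with 1 show ?thesis by simp
  qed

  have cover: "(\<Sum>k\<in>A i j. v (Suc i) k) \<le> s i j * v i j" if j: "j < m" for i j
  proof -
    have "(\<Sum>k\<in>A i j. v (Suc i) k) \<le> L (I (Suc i)) (hi i j) - R (I (Suc i)) (lo i j)"
      unfolding A_def v_def by (rule length_of_gaps[OF I_in lo_hi[OF j]])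
    also have "\<dots> \<le> s i j * v i j" using low[OF j, of i] high[OF j, of i] unfolding sv[OF j] by linarith
    finally show ?thesis .
  qed
  have v_pos: "0 < v i j" if "j < m" for i j using RL[OF I_in that, of i] by (simp add: v_def)
  have v_period: "v ?q j = v 0 j" for j by (simp add: v_def period)
  have s_pos: "0 < s i j" if "j < m" for i j unfolding s_def using that by (intro gap_slope_pos) auto
  have A_sub: "A i j \<subseteq> {..<m}" if "j < m" for i j using lo_hi[OF that, of i] by (auto simp: A_def)
  have \<pi>A: "\<pi> i j \<in> A i j" if "j < m" for i j using \<pi>[OF that, of i] by (simp add: A_def)
  have e_lt: "e i < m" for i using e by simp
  have eA: "e (Suc i) \<in> A i (e i)" for i using e_next by (simp add: A_def)
  define T where "T = (\<Prod>i<?q. \<Prod>j<m. s i j)"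
  define \<sigma> where "\<sigma> = (\<Prod>i<?q. s i (e i))"
  note loop = loop_of_covered_gaps[where v = v and s = s and A = A and \<pi> = \<pi> and e = e and q = ?q,
      OF v_pos v_period s_pos A_sub cover \<pi>_bij \<pi>A e_lt e_period eA, folded T_def \<sigma>_def]

  have \<sigma>_orbit: "\<sigma> = (\<Prod>i<?q. sl ((f ^^ i) p))"
    unfolding \<sigma>_def s_def using e gap_slope_eq[OF I_in] by (intro prod.cong refl) (simp flip: gap_slope_eq)
  obtain \<phi> where \<phi>: "\<phi> \<in> breaking_products" "\<sigma> = expansion C * \<phi>"
    using orbit_slope_product[OF p_gap] unfolding \<sigma>_orbit by blast
  have "T \<noteq> 1"
  proof
    assume T: "T = 1"
    define E where "E i = {R (I i) (e i), L (I i) (Suc (e i))}" for i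
    have E_step: "f ` E i \<subseteq> E (Suc i)" if i: "i < ?q" for i
    proof -
      let ?X = "I (Suc i)" and ?k = "e (Suc i)"
      have j: "e i < m" using e by simp
      have k: "lo i (e i) \<le> ?k" "Suc ?k \<le> hi i (e i)" "?k < m" using e_next[of i] e[of "Suc i"] by auto
      have "R ?X (lo i (e i)) \<le> R ?X ?k" using k by (intro R_mono[OF I_in]) auto
      moreover have "L ?X (Suc ?k) \<le> L ?X (hi i (e i))" using k lo_hi(2)[OF j, of i] by (intro L_mono[OF I_in]) auto
      moreover have "max (f (R (I i) (e i))) (f (L (I i) (Suc (e i)))) - min (f (R (I i) (e i))) (f (L (I i) (Suc (e i))))
          = L ?X (Suc ?k) - R ?X ?k"
        using loop(4)[OF _ _ _ _ _ T i] unfolding sv[OF j] by (simp add: v_def)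
      ultimately have "min (f (R (I i) (e i))) (f (L (I i) (Suc (e i)))) = R ?X ?k"
        "max (f (R (I i) (e i))) (f (L (I i) (Suc (e i)))) = L ?X (Suc ?k)"
        using low[OF j, of i] high[OF j, of i] by linarith+
      then show ?thesis by (auto simp: E_def min_def max_def split: if_splits)
    qed
    have E_iter: "n \<le> ?q \<Longrightarrow> (f ^^ n) ` E 0 \<subseteq> E n" for n
    proof (induction n)
      case (Suc n)
      have "(f ^^ Suc n) ` E 0 = f ` (f ^^ n) ` E 0" by (simp add: image_comp)
      also have "\<dots> \<subseteq> f ` E n" using Suc by (intro image_mono) simp
      also have "\<dots> \<subseteq> E (Suc n)" using Suc.prems by (intro E_step) simp
      finally show ?case .
    qed simp
    have "E ?q = E 0" by (simp add: E_def period e_period)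
    then have g: "(f ^^ ?q) ` E 0 \<subseteq> E 0" using E_iter[of ?q] by simp
    have E_D: "\<exists>Y\<in>D. x \<in> Y" if xE: "x \<in> E 0" for x
    proof -
      consider "x = R (I 0) (e 0)" | "x = L (I 0) (Suc (e 0))" using xE by (auto simp: E_def)
      then show ?thesis
      proof cases
        case 1
        have "x \<in> {L (I 0) (e 0)..R (I 0) (e 0)}" using 1 LR[OF I_in, of "e 0" 0] e[of 0] by simp
        then show ?thesis using piece(1)[OF I_in, of "e 0" 0] e[of 0] by (intro bexI) auto
      next
        case 2
        have "x \<in> {L (I 0) (Suc (e 0))..R (I 0) (Suc (e 0))}"
          using 2 LR[OF I_in, of "Suc (e 0)" 0] e[of 0] by simp
        then show ?thesis using piece(1)[OF I_in, of "Suc (e 0)" 0] e[of 0] by (intro bexI) auto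
      qed
    qed
    have no_return: "(f ^^ n) x \<noteq> x" if nx: "x \<in> E 0" "0 < n" "n \<le> 2 * ?q" for n x
    proof
      assume "(f ^^ n) x = x"
      moreover obtain Y where "Y \<in> D" "x \<in> Y" using E_D[OF nx(1)] by blast
      ultimately have "card D dvd n" using return_time[of Y x n] by simp
      then have "card D \<le> n" using that(2) by (rule dvd_imp_le)
      moreover have "3 * ?q \<le> card D" unfolding card_D using m by (intro mult_le_mono1) simp
      ultimately show False using that(3) C_pos by linarith
    qed
    define a where "a = R (I 0) (e 0)"
    define b where "b = L (I 0) (Suc (e 0))"
    have ab: "E 0 = {a, b}" by (simp add: E_def a_def b_def)
    \<comment> \<open>a return of \<open>a\<close> or \<open>b\<close> to itself after \<open>card C\<close> steps is too early, so the two points are exchanged\<close>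
    have once: "(f ^^ ?q) a = b" "(f ^^ ?q) b = a"
      using g no_return[of a ?q] no_return[of b ?q] C_pos unfolding ab by auto
    have "(f ^^ (?q + ?q)) a = a" unfolding funpow_add using once by simp
    then show False using no_return[of a "?q + ?q"] C_pos unfolding ab by simp
  qed
  then have "1 < T" using loop(1) by simp
  moreover have "expansion D = expansion C * T" unfolding expansion_D T_def s_def ..
  ultimately show ?thesis using loop(2,3) \<phi> by simp blast
qed

end

section \<open>Infinitely many refinements\<close>

context affine_pieces
begin

lemma expansion_of_refinement:
  assumes C: "is_cycle f C" and D: "is_cycle f D" and sub: "\<Union>D \<subseteq> \<Union>C"
    and m: "m \<ge> 3" and card_m: "\<And>X. X \<in> C \<Longrightarrow> card {Y \<in> D. Y \<subseteq> X} = m"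
    and nondeg: "\<And>Y. Y \<in> D \<Longrightarrow> Inf Y < Sup Y" and P_sub: "P \<inter> \<Union>C \<subseteq> \<Union>D"
    and unique: "\<And>X Y Z. X \<in> C \<Longrightarrow> Y \<in> D \<Longrightarrow> Z \<in> D \<Longrightarrow> Y \<subseteq> X \<Longrightarrow> Z \<subseteq> X \<Longrightarrow>
                 Y \<inter> P \<noteq> {} \<Longrightarrow> Z \<inter> P \<noteq> {} \<Longrightarrow> Y = Z"
  shows "\<exists>T. \<exists>\<phi>\<in>breaking_products. expansion D = expansion C * T \<and> 1 < T \<and> 1 \<le> expansion C * \<phi> \<and>
     (expansion C * \<phi> * (T - 1) < T \<longrightarrow> expansion C * \<phi> \<le> T)"
proof -
  obtain X0 where X0: "X0 \<in> C" using cycle_nonempty[OF C] by auto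
  have "card {Y \<in> D. Y \<subseteq> X0} \<noteq> 0" using card_m[OF X0] m by simp
  then have "{Y \<in> D. Y \<subseteq> X0} \<noteq> {}" by (metis card.empty)
  then obtain Y0 where Y0: "Y0 \<in> D" "Y0 \<subseteq> X0" by blast
  obtain I where I: "range I = C" "I 0 = X0" "\<forall>i. f ` I i \<subseteq> I (Suc i)"
    "\<forall>i j. I i = I j \<longleftrightarrow> i mod card C = j mod card C" "card C > 0" "bij_betw I {..<card C} C"
    by (rule cycle_enumeration[OF C X0], rule that)
  obtain J where J: "range J = D" "J 0 = Y0" "\<forall>i. f ` J i \<subseteq> J (Suc i)"
    "\<forall>i j. J i = J j \<longleftrightarrow> i mod card D = j mod card D" "card D > 0" "bij_betw J {..<card D} D"
    by (rule cycle_enumeration[OF D Y0(1)], rule that)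
  have I_in: "I i \<in> C" and J_in: "J i \<in> D" for i using I(1) J(1) by blast+
  obtain y where y: "y \<in> Y0" using cycle_nonempty_member[OF D Y0(1)] by blast
  have orbit: "(f ^^ i) y \<in> I i \<and> (f ^^ i) y \<in> J i" for i
  proof (induction i)
    case 0
    then show ?case using y Y0(2) I(2) J(2) by auto
  next
    case (Suc i)
    then show ?case using I(3)[rule_format, of i] J(3)[rule_format, of i] by auto
  qed
  have J_sub: "J i \<subseteq> I i" for i
  proof -
    obtain X where X: "X \<in> C" "J i \<subseteq> X" by (rule subcycle_member[OF C D sub J_in])
    have "X = I i" using X(2) orbit[of i] by (intro cycle_disjoint[OF C X(1) I_in, of "(f ^^ i) y"]) auto
    with X show ?thesis by simp
  qed
  have "\<forall>X. \<exists>L R. X \<in> C \<longrightarrow> {Y \<in> D. Y \<subseteq> X} = (\<lambda>j. {L j..R j}) ` {..<m} \<and> (\<forall>j<m. L j \<le> R j) \<and>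
           (\<forall>j. Suc j < m \<longrightarrow> R j < L (Suc j))"
  proof
    fix X
    show "\<exists>L R. X \<in> C \<longrightarrow> {Y \<in> D. Y \<subseteq> X} = (\<lambda>j. {L j..R j}) ` {..<m} \<and> (\<forall>j<m. L j \<le> R j) \<and>
           (\<forall>j. Suc j < m \<longrightarrow> R j < L (Suc j))"
    proof (cases "X \<in> C")
      case True
      have "\<exists>L R. {Y \<in> D. Y \<subseteq> X} = (\<lambda>j. {L j..R j}) ` {..<card {Y \<in> D. Y \<subseteq> X}} \<and>
        (\<forall>j<card {Y \<in> D. Y \<subseteq> X}. L j \<le> R j) \<and>
        (\<forall>j. Suc j < card {Y \<in> D. Y \<subseteq> X} \<longrightarrow> R j < L (Suc j))"
      proof (rule ordered_enumeration)
        show "finite {Y \<in> D. Y \<subseteq> X}" using cycle_finite[OF D] by simp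
        show "\<exists>a b. a \<le> b \<and> Z = {a..b}" if "Z \<in> {Y \<in> D. Y \<subseteq> X}" for Z
        proof -
          have "Z \<in> D" using that by simp
          then show ?thesis by (rule cycle_interval[OF D]) (intro exI conjI)
        qed
        show "Y = Z" if "Y \<in> {Y \<in> D. Y \<subseteq> X}" "Z \<in> {Y \<in> D. Y \<subseteq> X}" "x \<in> Y" "x \<in> Z" for Y Z x
          using that cycle_disjoint[OF D, of Y Z x] by simp
      qed
      then show ?thesis unfolding card_m[OF True] by blast
    qed simp
  qed
  from choice[OF this] obtain L where "\<forall>X. \<exists>R. X \<in> C \<longrightarrow> {Y \<in> D. Y \<subseteq> X} = (\<lambda>j. {L X j..R j}) ` {..<m} \<and>
      (\<forall>j<m. L X j \<le> R j) \<and> (\<forall>j. Suc j < m \<longrightarrow> R j < L X (Suc j))" ..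
  from choice[OF this] obtain R where "\<forall>X. X \<in> C \<longrightarrow> {Y \<in> D. Y \<subseteq> X} = (\<lambda>j. {L X j..R X j}) ` {..<m} \<and>
      (\<forall>j<m. L X j \<le> R X j) \<and> (\<forall>j. Suc j < m \<longrightarrow> R X j < L X (Suc j))" ..
  then have LR: "X \<in> C \<Longrightarrow> {Y \<in> D. Y \<subseteq> X} = (\<lambda>j. {L X j..R X j}) ` {..<m} \<and>
      (\<forall>j<m. L X j \<le> R X j) \<and> (\<forall>j. Suc j < m \<longrightarrow> R X j < L X (Suc j))" for X
    by (elim allE impE)
  have "{..m - 1} = {..<m}" using m by auto
  interpret ordered_refinement f sl P C D "m - 1" I J L R
  proof
    show "{Y \<in> D. Y \<subseteq> X} = (\<lambda>j. {L X j..R X j}) ` {..m - 1}" if "X \<in> C" for X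
      unfolding \<open>{..m - 1} = {..<m}\<close> using LR[OF that] by (rule conjunct1)
    show "L X j \<le> R X j" if "X \<in> C" "j \<le> m - 1" for X j using LR[OF that(1)] that(2) m by simp
    show "R X j < L X (Suc j)" if "X \<in> C" "j < m - 1" for X j using LR[OF that(1)] that(2) m by simp
    show "card {Y \<in> D. Y \<subseteq> X} = Suc (m - 1)" if "X \<in> C" for X using card_m[OF that] m by simp
    show "I i = I j \<longleftrightarrow> i mod card C = j mod card C" for i j using I(4) by blast
    show "J i = J j \<longleftrightarrow> i mod card D = j mod card D" for i j using J(4) by blast
  qed (use C D sub m nondeg P_sub unique I J J_sub in simp_all)
  show ?thesis by (rule expansion_step)
qed

text \<open>
  The relation \<open>E n\<close> of lying in a common interval of the \<open>n\<close>-th cycle, for breakpoints,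
  decreases with \<open>n\<close> and is finite, hence finally constant. Constancy on the diagonal means
  that no breakpoint is lost, off the diagonal that none are separated.
\<close>

lemma no_infinite_refinement:
  assumes C: "\<And>n. is_cycle f (C n)" and sub: "\<And>n. \<Union>(C (Suc n)) \<subseteq> \<Union>(C n)"
    and ref: "\<And>n. \<exists>m\<ge>3. \<forall>X\<in>C n. card {Y \<in> C (Suc n). Y \<subseteq> X} = m"
  shows False
proof -
  have nondeg: "Inf X < Sup X" if "X \<in> C n" for X n
  proof -
    obtain m where "m \<ge> 3" "\<forall>X\<in>C n. card {Y \<in> C (Suc n). Y \<subseteq> X} = m" using ref[of n] by blast
    then show ?thesis using that by (intro refined_nondegenerate[OF C C[of "Suc n"] that]) simp
  qed
  define E where "E n = {(x, y). x \<in> P \<and> y \<in> P \<and> (\<exists>X\<in>C n. x \<in> X \<and> y \<in> X)}" for n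
  have E_fin: "finite (E n)" for n
    using finite_P by (intro finite_subset[OF _ finite_cartesian_product[of P P]]) (auto simp: E_def)
  have "E (Suc n) \<subseteq> E n" for n
  proof
    fix z assume "z \<in> E (Suc n)"
    then obtain x y Y where Y: "z = (x, y)" "x \<in> P" "y \<in> P" "Y \<in> C (Suc n)" "x \<in> Y" "y \<in> Y"
      by (auto simp: E_def)
    obtain X where "X \<in> C n" "Y \<subseteq> X" by (rule subcycle_member[OF C C sub Y(4)])
    then show "z \<in> E n" using Y by (auto simp: E_def)
  qed
  then have E_anti: "E n \<subseteq> E k" if "k \<le> n" for k n using that by (rule lift_Suc_antimono_le)
  \<comment> \<open>from the index \<open>N\<close> of a smallest relation on, the relation is constant\<close>
  obtain N where N: "\<And>n. card (E N) \<le> card (E n)" using ex_has_least_nat[of "\<lambda>_. True" _ "\<lambda>n. card (E n)"] by blast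
  have E_const: "E n = E N" if "N \<le> n" for n
    by (rule card_seteq[OF E_fin E_anti[OF that] N])
  have step: "\<exists>T. \<exists>\<phi>\<in>breaking_products. expansion (C (Suc n)) = expansion (C n) * T \<and> 1 < T \<and>
      1 \<le> expansion (C n) * \<phi> \<and> (expansion (C n) * \<phi> * (T - 1) < T \<longrightarrow> expansion (C n) * \<phi> \<le> T)"
    if n: "N \<le> n" for n
  proof -
    obtain m where m: "m \<ge> 3" "\<And>X. X \<in> C n \<Longrightarrow> card {Y \<in> C (Suc n). Y \<subseteq> X} = m" using ref[of n] by blast
    have E: "E (Suc n) = E n" using E_const[of n] E_const[of "Suc n"] n by simp
    show ?thesis
    proof (rule expansion_of_refinement[OF C C sub m nondeg])
      show "P \<inter> \<Union>(C n) \<subseteq> \<Union>(C (Suc n))"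
      proof
        fix x assume "x \<in> P \<inter> \<Union>(C n)"
        then have "(x, x) \<in> E (Suc n)" unfolding E by (auto simp: E_def)
        then show "x \<in> \<Union>(C (Suc n))" by (auto simp: E_def)
      qed
      fix X Y Z assume XYZ: "X \<in> C n" "Y \<in> C (Suc n)" "Z \<in> C (Suc n)" "Y \<subseteq> X" "Z \<subseteq> X"
        "Y \<inter> P \<noteq> {}" "Z \<inter> P \<noteq> {}"
      then obtain y z where yz: "y \<in> Y" "y \<in> P" "z \<in> Z" "z \<in> P" by blast
      then have "(y, z) \<in> E (Suc n)" unfolding E using XYZ by (auto simp: E_def)
      then obtain W where W: "W \<in> C (Suc n)" "y \<in> W" "z \<in> W" by (auto simp: E_def)
      have "Y = W" by (rule cycle_disjoint[OF C XYZ(2) W(1) yz(1) W(2)])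
      moreover have "Z = W" by (rule cycle_disjoint[OF C XYZ(3) W(1) yz(3) W(3)])
      ultimately show "Y = Z" by simp
    qed
  qed
  define \<Lambda> where "\<Lambda> n = expansion (C (N + n))" for n
  have "\<forall>n. \<exists>T. \<exists>\<phi>. \<phi> \<in> breaking_products \<and> \<Lambda> (Suc n) = \<Lambda> n * T \<and> 1 < T \<and>
      1 \<le> \<Lambda> n * \<phi> \<and> (\<Lambda> n * \<phi> * (T - 1) < T \<longrightarrow> \<Lambda> n * \<phi> \<le> T)"
    using step[OF le_add1] unfolding \<Lambda>_def add_Suc_right by blast
  then obtain T \<phi> where \<phi>: "\<And>n. \<phi> n \<in> breaking_products" and \<Lambda>T: "\<And>n. \<Lambda> (Suc n) = \<Lambda> n * T n"
    and T: "\<And>n. 1 < T n" and \<sigma>: "\<And>n. 1 \<le> \<Lambda> n * \<phi> n"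
    and gap: "\<And>n. \<Lambda> n * \<phi> n * (T n - 1) < T n \<Longrightarrow> \<Lambda> n * \<phi> n \<le> T n"
    by metis
  have \<Lambda>_pos: "0 < \<Lambda> n" for n unfolding \<Lambda>_def by (rule expansion_pos[OF C])
  have \<Lambda>_less: "\<Lambda> n < \<Lambda> (Suc n)" for n using \<Lambda>T[of n] T[of n] \<Lambda>_pos[of n] by simp
  have mono: "incseq \<Lambda>" using \<Lambda>_less by (intro incseq_SucI less_imp_le)
  obtain B where B: "\<And>n. \<Lambda> n \<le> B"
    using expansion_bounded C nondeg unfolding \<Lambda>_def by blast
  obtain l where l: "\<Lambda> \<longlonglongrightarrow> l" "\<And>n. \<Lambda> n \<le> l"
    using incseq_convergent[OF mono] B by blast
  have l_pos: "0 < l" using \<Lambda>_pos[of 0] l(2)[of 0] by linarith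
  have T_lim: "T \<longlonglongrightarrow> 1"
  proof -
    have "(\<lambda>n. \<Lambda> (Suc n) / \<Lambda> n) \<longlonglongrightarrow> l / l"
      using l_pos by (intro tendsto_divide LIMSEQ_Suc l(1)) simp
    moreover have "\<Lambda> (Suc n) / \<Lambda> n = T n" for n using \<Lambda>T[of n] \<Lambda>_pos[of n] by simp
    ultimately show ?thesis using l_pos by simp
  qed
  have "finite (insert 1 breaking_products)" using finite_breaking_products by simp
  then have M: "\<phi> n \<le> Max (insert 1 breaking_products)" for n using \<phi>[of n] by (intro Max_ge) auto
  define M where "M = Max (insert 1 breaking_products)"
  have \<sigma>M: "\<Lambda> n * \<phi> n \<le> l * M" for n
  proof -
    have "0 \<le> \<phi> n" using \<sigma>[of n] \<Lambda>_pos[of n] by (auto simp: zero_le_mult_iff intro: ccontr dest: order_trans[OF zero_le_one])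
    then show ?thesis using M[of n] l(2)[of n] l_pos by (intro mult_mono) (auto simp: M_def)
  qed
  have "(\<lambda>n. l * M * (T n - 1)) \<longlonglongrightarrow> l * M * (1 - 1)" by (intro tendsto_intros T_lim)
  then have "eventually (\<lambda>n. l * M * (T n - 1) < 1) sequentially"
    by (intro order_tendstoD(2)[of _ "l * M * (1 - 1)"]) auto
  then have \<sigma>T: "eventually (\<lambda>n. \<Lambda> n * \<phi> n \<le> T n) sequentially"
  proof eventually_elim
    case (elim n)
    have "\<Lambda> n * \<phi> n * (T n - 1) \<le> l * M * (T n - 1)"
      using \<sigma>M[of n] T[of n] by (intro mult_right_mono) auto
    then show ?case using gap[of n] elim T[of n] by linarith
  qed
  have "(\<lambda>n. \<Lambda> n * \<phi> n) \<longlonglongrightarrow> 1"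
    by (rule tendsto_sandwich[OF _ \<sigma>T tendsto_const T_lim]) (simp add: \<sigma>)
  then have "(\<lambda>n. \<Lambda> n * \<phi> n / \<Lambda> n) \<longlonglongrightarrow> 1 / l"
    using l_pos by (intro tendsto_divide l(1)) auto
  then have \<phi>_lim: "\<phi> \<longlonglongrightarrow> 1 / l" using less_imp_neq[OF \<Lambda>_pos, symmetric] by simp
  \<comment> \<open>a finite set is discrete, so a convergent sequence in it reaches its limit\<close>
  have "open (- (breaking_products - {1 / l}))"
    using finite_breaking_products by (intro open_Compl finite_imp_closed) simp
  then have "eventually (\<lambda>n. \<phi> n \<in> - (breaking_products - {1 / l})) sequentially"
    by (rule topological_tendstoD[OF \<phi>_lim]) simp
  then obtain n where "\<phi> n \<in> - (breaking_products - {1 / l})"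
    by (auto simp: eventually_sequentially)
  then have "\<phi> n = 1 / l" using \<phi>[of n] by simp
  then have "1 \<le> \<Lambda> n / l" using \<sigma>[of n] by simp
  then have "l \<le> \<Lambda> n" using l_pos by simp
  then show False using \<Lambda>_less[of n] l(2)[of "Suc n"] by linarith
qed

end

text \<open>
  The end points 0 and 1 are counted as breakpoints, so that the derivative exists at all
  other points of the unit interval.
\<close>

lemma piecewise_affine_slopes:
  assumes "piecewise_affine f"
  obtains P where "affine_pieces f (\<lambda>x. \<bar>deriv f x\<bar>) P"
proof -
  obtain c :: "nat \<Rightarrow> real" and n where f: "interval_map f" and c: "c 0 = 0" "c n = 1"
    and aff: "\<forall>i<n. \<exists>a. a \<noteq> 0 \<and> affine_with_slope f a {c i..c (Suc i)}"
    using assms unfolding piecewise_affine_def by blast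
  from aff have "\<forall>i. \<exists>a b. i < n \<longrightarrow> a \<noteq> 0 \<and> (\<forall>x\<in>{c i..c (Suc i)}. f x = a * x + b)"
    unfolding affine_with_slope_def by blast
  then obtain a b where a: "\<And>i. i < n \<Longrightarrow> a i \<noteq> 0"
    and fx: "\<And>i x. i < n \<Longrightarrow> x \<in> {c i..c (Suc i)} \<Longrightarrow> f x = a i * x + b i" by metis
  have piece: "\<exists>i<n. c i \<le> x \<and> x < c (Suc i)" if "0 \<le> x" "x < 1" for x
  proof -
    have "\<exists>k<n. (\<forall>i\<le>k. \<not> x < c i) \<and> x < c (Suc k)"
      using that c by (intro ex_least_nat_less) auto
    then show ?thesis by (meson not_less order_refl)
  qed
  have deriv: "deriv f x = a i" if "i < n" "c i < x" "x < c (Suc i)" for i x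
  proof -
    have "((\<lambda>x. a i * x + b i) has_field_derivative a i) (at x)" by (auto intro!: derivative_eq_intros)
    then have "(f has_field_derivative a i) (at x)"
      by (rule has_field_derivative_transform_within_open[of _ _ _ "{c i<..<c (Suc i)}"])
        (use that fx[OF that(1)] in auto)
    then show ?thesis by (rule DERIV_imp_deriv)
  qed
  define P where "P = c ` {..n}"
  have off: "\<exists>i<n. \<bar>deriv f x\<bar> = \<bar>a i\<bar>" if xP: "x \<in> {0..1} - P" for x
  proof -
    have "c 0 \<in> P" "c n \<in> P" by (auto simp: P_def)
    then have "0 \<le> x" "x < 1" using xP c by (auto simp: less_le)
    then obtain i where i: "i < n" "c i \<le> x" "x < c (Suc i)" using piece[of x] by auto
    moreover have "c i \<noteq> x" using xP i(1) by (auto simp: P_def)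
    ultimately show ?thesis using deriv[of i x] by auto
  qed
  have "affine_pieces f (\<lambda>x. \<bar>deriv f x\<bar>) P"
  proof
    show "continuous_on {0..1} f" "f ` {0..1} \<subseteq> {0..1}" using f by (auto simp: interval_map_def)
    show "finite P" by (simp add: P_def)
    have "(\<lambda>x. \<bar>deriv f x\<bar>) ` ({0..1} - P) \<subseteq> (\<lambda>i. \<bar>a i\<bar>) ` {..<n}" using off by fastforce
    then show "finite ((\<lambda>x. \<bar>deriv f x\<bar>) ` ({0..1} - P))" by (rule finite_subset) simp
    show "0 < \<bar>deriv f x\<bar>" if "x \<in> {0..1} - P" for x using off[OF that] a by auto
    fix u v z x y
    assume uv: "0 \<le> u" "v \<le> 1" "{u<..<v} \<inter> P = {}" "z \<in> {u<..<v}" and xy: "x \<in> {u..v}" "y \<in> {u..v}"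
    obtain i where i: "i < n" "c i \<le> u" "u < c (Suc i)" using piece[of u] uv by auto
    have "c (Suc i) \<in> P" using i(1) by (simp add: P_def)
    then have "v \<le> c (Suc i)" using uv(3) i(3) by (metis disjoint_iff greaterThanLessThan_iff not_less)
    then have "f x = a i * x + b i" "f y = a i * y + b i" "deriv f z = a i"
      using xy uv(4) i by (auto intro!: fx deriv)
    then show "\<bar>f x - f y\<bar> = \<bar>deriv f z\<bar> * \<bar>x - y\<bar>"
      by (simp add: abs_mult[symmetric] algebra_simps)
  qed
  then show thesis by (rule that)
qed

theorem theoremC:
  "\<not> (\<exists>f :: real \<Rightarrow> real. piecewise_affine f \<and> infinitely_renormalizable f)"
proof
  assume "\<exists>f :: real \<Rightarrow> real. piecewise_affine f \<and> infinitely_renormalizable f"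
  then obtain f :: "real \<Rightarrow> real" and C where f: "piecewise_affine f"
    and C: "\<And>n. is_cycle f (C n)" "\<And>n. cycle_refines (C (Suc n)) (C n)"
    unfolding infinitely_renormalizable_def by blast
  obtain P where "affine_pieces f (\<lambda>x. \<bar>deriv f x\<bar>) P" by (rule piecewise_affine_slopes[OF f])
  then interpret affine_pieces f "\<lambda>x. \<bar>deriv f x\<bar>" P .
  show False
  proof (rule no_infinite_refinement[of "\<lambda>n. C (2 * n)"])
    fix n
    have twice: "cycle_refines (C (Suc (2 * n))) (C (2 * n))" "cycle_refines (C (Suc (Suc (2 * n)))) (C (Suc (2 * n)))"
      by (rule C(2))+
    show "is_cycle f (C (2 * n))" by (rule C(1))
    show "\<Union>(C (2 * Suc n)) \<subseteq> \<Union>(C (2 * n))"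
      using refinement_step_twice(1)[OF C(1) C(1) C(1) twice] by simp
    show "\<exists>m\<ge>3. \<forall>X\<in>C (2 * n). card {Y \<in> C (2 * Suc n). Y \<subseteq> X} = m"
      using refinement_step_twice(2)[OF C(1) C(1) C(1) twice] by simp
  qed
qed

end
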